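(* Let $G\subseteq GL_n(\mathbb{C})$ be an abelian matrix group, and consider a generating set $\{A_i\}$ for $G$. Let $\lambda_{i,1},\dots,\lambda_{i,n}$ be the eigenvalues of $A_i$ for each $i$. Then $$\mathrm{HS}(G) = \bigcup_{j=1}^n \mathrm{HS}\big(\langle \{\lambda_{i,j}\}_{i} \rangle\big).$$ In particular, $\mathrm{HS}(G)$ is a union of five types of sets: $\mathbb{C}$, $\mathbb{R}$, $\mathbb{R}^+$, $\Pi_k$, and $B'_\alpha$.
   Context: For a set $S \subseteq M_n(\mathbb{C})$ of $n$-by-$n$ complex matrices, $\mathrm{Co}(S)$ denotes the set of all convex combinations of elements of $S$, and the hull spectrum $\mathrm{HS}(S)\subseteq\mathbb{C}$ is the set of all complex numbers that occur as eigenvalues of some matrix in $\mathrm{Co}(S)$. Nonzero complex numbers are regarded as invertible $1$-by-$1$ matrices, and for a set $\Lambda$ of nonzero complex numbers, $\langle\Lambda\rangle$ is the multiplicative group it generates. $\Pi_k$ denotes the convex hull in $\mathbb{C}$ of the $k$th roots of unity; $\mathbb{R}^+$ is the set of strictly positive real numbers; $B_1$ is the open unit disc of the complex plane; and $B'_\alpha = B_1\cup\{e^{2\pi i\alpha m}: m\in\mathbb{Z}\}$ for real $\alpha$.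
   Formalization: The eigenvalues λ_{i,1},…,λ_{i,n} are required to be listed in compatible order for all i, as the diagonals of one simultaneous triangularization of the A_i (shown to exist); with unrelated orderings the formula fails, e.g. for diag(1,−1), diag(1,ω), ω a primitive cube root of 1. *)

theory Defs
  imports
    "HOL-Analysis.Analysis"
    "HOL-Algebra.Generated_Groups"
    "Jordan_Normal_Form.Char_Poly"
begin

definition GL :: "nat \<Rightarrow> complex mat monoid" where
  "GL n = units_of (ring_mat TYPE(complex) n ())"

(* Complex matrices of all sizes share one type, which is not an instance of real_vector,
   so the constant "convex hull" does not apply; the combinations are formed entrywise. *)
definition Co :: "nat \<Rightarrow> complex mat set \<Rightarrow> complex mat set" where
  "Co n S = {Matrix.mat n n (\<lambda>(r, c). \<Sum>M\<in>T. complex_of_real (u M) * M $$ (r, c)) | T u.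
     finite T \<and> T \<subseteq> S \<and> (\<forall>M\<in>T. 0 \<le> u M) \<and> (\<Sum>M\<in>T. u M) = (1::real)}"

definition HS :: "nat \<Rightarrow> complex mat set \<Rightarrow> complex set" where
  "HS n S = {z. \<exists>M\<in>Co n S. eigenvalue M z}"

definition scalar_mat :: "complex \<Rightarrow> complex mat" where
  "scalar_mat z = Matrix.mat 1 1 (\<lambda>_. z)"

definition scalar_group :: "complex set \<Rightarrow> complex mat set" where
  "scalar_group \<Lambda> = generate (GL 1) (scalar_mat ` \<Lambda>)"

(* lam i 0, ..., lam i (n - 1) lists the eigenvalues of A i with multiplicity. The lists for
   different i have to be ordered compatibly: for the commuting matrices diag(1, -1) and
   diag(1, w), with w a primitive cube root of unity, sorting the two spectra independently of
   each other changes the groups generated by the lam i j for fixed j. The compatible orderings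
   are those read off the diagonals of a simultaneous triangularization. *)
definition joint_eigenvalues ::
  "nat \<Rightarrow> 'i set \<Rightarrow> ('i \<Rightarrow> complex mat) \<Rightarrow> ('i \<Rightarrow> nat \<Rightarrow> complex) \<Rightarrow> bool" where
  "joint_eigenvalues n I A lam \<longleftrightarrow>
     (\<forall>i\<in>I. char_poly (A i) = (\<Prod>j<n. [:- lam i j, 1:])) \<and>
     (\<exists>P Q. \<forall>i\<in>I. \<exists>B. similar_mat_wit (A i) B P Q \<and> upper_triangular B \<and>
        (\<forall>j<n. B $$ (j, j) = lam i j))"

definition root_polygon :: "nat \<Rightarrow> complex set" where
  "root_polygon k = convex hull {z. z ^ k = 1}"

definition disc_with_orbit :: "real \<Rightarrow> complex set" where
  "disc_with_orbit \<alpha> = ball 0 1 \<union> range (\<lambda>m::int. cis (2 * pi * \<alpha> * real_of_int m))"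

definition hull_types :: "complex set set" where
  "hull_types = {UNIV, \<real>, complex_of_real ` {0<..}} \<union> root_polygon ` {1..} \<union>
     range disc_with_orbit"

end

(* An abelian group G is simultaneously triangularizable, and after conjugation each diagonal
   position is a character of G. The eigenvalues of a convex combination of elements of G are its
   diagonal entries, which are the same convex combinations of character values. Hence HS(G) is the
   union of the convex hulls of the character images, which are the groups generated by the
   lambda_{i,j} for fixed j.
   A finite subgroup of the nonzero complex numbers consists of roots of unity. An infinite one in
   the unit circle is dense there, so its hull is the open disc together with the group. One that
   contains a number off the circle has hull R^+, R or, if it contains a non-real number, C. *)
theory Submission
  imports
    Defs
    "Jordan_Normal_Form.Schur_Decomposition"
    "HOL-Library.Function_Algebras"
begin

section \<open>Convex hulls of multiplicative groups of complex numbers\<close>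

text \<open>An infinite subgroup of the circle need not be cyclic: the group of all roots of unity
  is not. Its hull is then described by the union of those B'_\<alpha> with exp(2 pi i \<alpha>) in
  the group. The powers of a non-real z off the circle need not have dense directions, since the
  argument of z may be a rational multiple of pi. That the hull is all of C is shown by refuting a
  separating half plane, with an argument on bounded partial sums that treats rational and
  irrational multiples alike. The conjugating matrices that come with given joint eigenvalues
  triangularize the generators only, and need not be those produced by simultaneous
  triangularization. So triangularity is carried from generators to the whole group through products
  and inverses, and the diagonal characters are set up for an arbitrary conjugating pair.\<close>

lemma norm_cis_diff_le: "norm (cis a - cis b) \<le> \<bar>a - b\<bar>"
proof -
  have "cis a - cis b = cis b * (cis (a - b) - 1)"
    by (simp add: algebra_simps cis_mult)
  then have "norm (cis a - cis b) = norm (cis (a - b) - 1)"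
    by (simp add: norm_mult)
  also have "\<dots> = 2 * \<bar>sin ((a - b) / 2)\<bar>"
    using dist_exp_i_1[of "a - b"] by (simp add: cis_conv_exp)
  also have "\<dots> \<le> \<bar>a - b\<bar>"
    using abs_sin_x_le_abs_x[of "(a - b) / 2"] by simp
  finally show ?thesis .
qed

text \<open>A convex set pulls back along \<open>of_real\<close> to an interval. This fills the gaps
  between group elements on the real axis.\<close>

lemma convex_of_real_between:
  fixes S :: "'a :: real_normed_algebra_1 set"
  assumes "convex S" "of_real a \<in> S" "of_real b \<in> S" "a \<le> x" "x \<le> b"
  shows "of_real x \<in> S"
proof -
  have "convex (of_real -` S :: real set)"
    by (intro convex_linear_vimage bounded_linear.linear bounded_linear_of_real assms)
  then have "is_interval (of_real -` S :: real set)"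
    by (simp add: is_interval_convex_1)
  then show ?thesis
    using mem_is_interval_1_I[of "of_real -` S" a b x] assms by auto
qed

text \<open>The group is a plain set under field operations, so that convexity arguments need no
  group records. The instances are the images of the diagonal characters.\<close>

locale nonzero_complex_subgroup =
  fixes \<Gamma> :: "complex set"
  assumes one_mem: "1 \<in> \<Gamma>"
    and mult_mem: "x \<in> \<Gamma> \<Longrightarrow> y \<in> \<Gamma> \<Longrightarrow> x * y \<in> \<Gamma>"
    and inverse_mem: "x \<in> \<Gamma> \<Longrightarrow> inverse x \<in> \<Gamma>"
    and zero_notin: "0 \<notin> \<Gamma>"
begin

lemma power_mem: "x \<in> \<Gamma> \<Longrightarrow> x ^ k \<in> \<Gamma>"
  by (induction k) (auto intro: one_mem mult_mem)

lemma power_int_mem: "x \<in> \<Gamma> \<Longrightarrow> x powi m \<in> \<Gamma>"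
  by (auto simp: power_int_def intro: power_mem inverse_mem)

text \<open>Multiplication by z permutes the group, so the product of all elements is unchanged when
  each factor is multiplied by z; cancelling it leaves z ^ k = 1 with k the order. As there are
  exactly k such roots, the inclusion is an equality.\<close>

lemma finite_eq_roots_of_unity:
  assumes "finite \<Gamma>"
  shows "\<Gamma> = {z. z ^ card \<Gamma> = 1}" and "card \<Gamma> > 0"
proof -
  show pos: "card \<Gamma> > 0"
    using assms one_mem card_gt_0_iff by blast
  have "z ^ card \<Gamma> = 1" if z: "z \<in> \<Gamma>" for z
  proof -
    have z0: "z \<noteq> 0"
      using z zero_notin by auto
    have inj: "inj_on ((*) z) \<Gamma>"
      using z0 by (auto simp: inj_on_def)
    have "(*) z ` \<Gamma> = \<Gamma>"
      using inj assms z mult_mem by (intro endo_inj_surj) auto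
    then have "(\<Prod>x\<in>\<Gamma>. x) = (\<Prod>x\<in>(*) z ` \<Gamma>. x)"
      by simp
    also have "\<dots> = (\<Prod>x\<in>\<Gamma>. z * x)"
      using inj by (subst prod.reindex) auto
    also have "\<dots> = z ^ card \<Gamma> * (\<Prod>x\<in>\<Gamma>. x)"
      by (simp add: prod.distrib)
    finally have "(\<Prod>x\<in>\<Gamma>. x) = z ^ card \<Gamma> * (\<Prod>x\<in>\<Gamma>. x)" .
    moreover have "(\<Prod>x\<in>\<Gamma>. x) \<noteq> 0"
      using assms zero_notin by auto
    ultimately show ?thesis by simp
  qed
  then have sub: "\<Gamma> \<subseteq> {z. z ^ card \<Gamma> = 1}" by blast
  show "\<Gamma> = {z. z ^ card \<Gamma> = 1}"
  proof (rule card_subset_eq[OF _ sub])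
    show "finite {z::complex. z ^ card \<Gamma> = 1}"
      using pos by (intro finite_roots_unity) auto
    show "card \<Gamma> = card {z::complex. z ^ card \<Gamma> = 1}"
      using pos card_roots_unity_eq by simp
  qed
qed

section \<open>Infinite subgroups of the unit circle\<close>

lemma small_rotation:
  assumes "infinite \<Gamma>" and circle: "\<Gamma> \<subseteq> sphere 0 1" and "\<epsilon> > 0"
  obtains \<theta> where "0 < \<theta>" "\<theta> < \<epsilon>" "cis \<theta> \<in> \<Gamma>"
proof -
  have cis_Arg': "cis (Arg x) = x" if "x \<in> \<Gamma>" for x
    using circle that by (subst cis_Arg) (auto simp: sgn_eq)
  have "inj_on Arg \<Gamma>"
    using cis_Arg' by (metis inj_onI)
  then have inf: "infinite (Arg ` \<Gamma>)"
    using assms(1) finite_image_iff by blast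
  \<comment> \<open>Infinitely many arguments in a compact interval accumulate at some l. Two
    elements with distinct arguments near l have as quotient a rotation by a small angle.\<close>
  have "Arg ` \<Gamma> \<subseteq> {-pi..pi}"
    by (auto intro: less_imp_le[OF conjunct1[OF Arg_bounded]] conjunct2[OF Arg_bounded])
  then obtain l where l: "l islimpt (Arg ` \<Gamma>)"
    using Heine_Borel_imp_Bolzano_Weierstrass[OF compact_Icc inf] by blast
  obtain x where x: "x \<in> \<Gamma>" "Arg x \<noteq> l" "\<bar>Arg x - l\<bar> < \<epsilon> / 2"
    using l \<open>\<epsilon> > 0\<close> unfolding islimpt_approachable
    by (metis dist_real_def half_gt_zero imageE)
  \<comment> \<open>Taking y strictly closer to l than x forces their arguments to differ; the two
    halves of \<epsilon> bound the difference.\<close>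
  obtain y where y: "y \<in> \<Gamma>" "Arg y \<noteq> l" "\<bar>Arg y - l\<bar> < min (\<epsilon> / 2) \<bar>Arg x - l\<bar>"
  proof -
    have "min (\<epsilon> / 2) \<bar>Arg x - l\<bar> > 0"
      using x \<open>\<epsilon> > 0\<close> by auto
    then show ?thesis
      using l that unfolding islimpt_approachable by (metis dist_real_def imageE)
  qed
  have rot: "cis (Arg u - Arg v) \<in> \<Gamma>" if "u \<in> \<Gamma>" "v \<in> \<Gamma>" for u v
    using that mult_mem[OF that(1) inverse_mem[OF that(2)]] cis_Arg'
    by (metis cis_divide divide_inverse)
  show ?thesis
  proof (cases "Arg x > Arg y")
    case True
    then show ?thesis
      using that[of "Arg x - Arg y"] rot[OF x(1) y(1)] x y by auto
  next
    case False
    then show ?thesis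
      using that[of "Arg y - Arg x"] rot[OF y(1) x(1)] x y by auto
  qed
qed

text \<open>The integer powers of a rotation by \<theta> < \<epsilon> leave only gaps of length at
  most \<theta> on the circle; rounding \<phi> / \<theta> down selects a suitable power.\<close>

lemma dense_in_circle:
  assumes "infinite \<Gamma>" "\<Gamma> \<subseteq> sphere 0 1" "norm e = 1"
  shows "e \<in> closure \<Gamma>"
  unfolding closure_approachable
proof (intro allI impI)
  fix \<epsilon> :: real
  assume "\<epsilon> > 0"
  then obtain \<theta> where \<theta>: "0 < \<theta>" "\<theta> < \<epsilon>" "cis \<theta> \<in> \<Gamma>"
    using small_rotation assms by blast
  define \<phi> where "\<phi> = Arg e"
  have e: "e = cis \<phi>"
    unfolding \<phi>_def using assms(3) by (subst cis_Arg) (auto simp: sgn_eq)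
  define m where "m = \<lfloor>\<phi> / \<theta>\<rfloor>"
  have "of_int m \<le> \<phi> / \<theta>" "\<phi> / \<theta> < of_int m + 1"
    unfolding m_def by linarith+
  then have m: "of_int m * \<theta> \<le> \<phi>" "\<phi> < of_int m * \<theta> + \<theta>"
    using \<theta> by (auto simp: field_simps)
  have "dist (cis \<theta> powi m) e = norm (cis (of_int m * \<theta>) - cis \<phi>)"
    by (simp add: e dist_norm cis_power_int)
  also have "\<dots> \<le> \<bar>of_int m * \<theta> - \<phi>\<bar>"
    by (rule norm_cis_diff_le)
  also have "\<dots> < \<epsilon>"
    using m \<theta> by linarith
  finally show "\<exists>y\<in>\<Gamma>. dist y e < \<epsilon>"
    using power_int_mem[OF \<theta>(3)] by blast
qed

lemma hull_infinite_circle: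
  assumes "infinite \<Gamma>" "\<Gamma> \<subseteq> sphere 0 1"
  shows "convex hull \<Gamma> = ball 0 1 \<union> \<Gamma>"
proof (rule antisym)
  show "convex hull \<Gamma> \<subseteq> ball 0 1 \<union> \<Gamma>"
  proof (rule hull_minimal)
    show "convex (ball 0 1 \<union> \<Gamma>)"
      unfolding convex_contains_open_segment
    proof (intro ballI subsetI)
      fix a b x
      assume ab: "a \<in> ball 0 1 \<union> \<Gamma>" "b \<in> ball 0 1 \<union> \<Gamma>" and x: "x \<in> open_segment a b"
      \<comment> \<open>Strict convexity of the disc: no interior point of a chord lies on the
        circle, so adding any set of boundary points to the open disc keeps it convex.\<close>
      have "dist 0 x < dist 0 a \<or> dist 0 x < dist 0 b"
        using dist_decreases_open_segment[OF x] by blast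
      moreover have "norm a \<le> 1" "norm b \<le> 1"
        using ab assms(2) by auto
      ultimately show "x \<in> ball 0 1 \<union> \<Gamma>" by auto
    qed
  qed auto
  have "p \<in> convex hull \<Gamma>" if p: "norm p < 1" for p
  proof (rule ccontr)
    assume "p \<notin> convex hull \<Gamma>"
    then obtain a b where a: "a \<noteq> 0" and ab: "\<forall>x\<in>convex hull \<Gamma>. inner a x \<le> b" "b \<le> inner a p"
      using separating_hyperplane_sets[of "convex hull \<Gamma>" "{p}"] one_mem by auto
    have "inner a x \<le> b" if "x \<in> \<Gamma>" for x
      using ab(1) hull_inc[OF that] by (rule bspec)
    then have "closure \<Gamma> \<subseteq> {x. inner a x \<le> b}"
      by (intro closure_minimal closed_halfspace_le subsetI CollectI)
    \<comment> \<open>The half plane contains the closure of \<Gamma>, hence by density the unit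
      vector in the direction a, where the functional takes its maximum |a| on the closed disc. At p
      it is smaller.\<close>
    moreover have "sgn a \<in> closure \<Gamma>"
      using a assms by (intro dense_in_circle) (auto simp: norm_sgn)
    ultimately have "inner a (sgn a) \<le> b" by blast
    moreover have "inner a (sgn a) = norm a"
      using a by (simp add: sgn_div_norm dot_square_norm power2_eq_square)
    moreover have "inner a p \<le> norm a * norm p"
      by (rule norm_cauchy_schwarz)
    moreover have "norm a * norm p < norm a * 1"
      using a p by (intro mult_strict_left_mono) auto
    ultimately show False using ab(2) by linarith
  qed
  then show "ball 0 1 \<union> \<Gamma> \<subseteq> convex hull \<Gamma>"
    by (auto simp: hull_inc)
qed

section \<open>Subgroups with an element off the unit circle\<close>

lemma hull_nonreal:
  assumes z: "z \<in> \<Gamma>" "norm z > 1" "z \<notin> \<real>"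
  shows "convex hull \<Gamma> = UNIV"
proof (rule ccontr)
  assume "convex hull \<Gamma> \<noteq> UNIV"
  then obtain p where "p \<notin> convex hull \<Gamma>" by blast
  then obtain a b where a: "a \<noteq> 0" and ab: "\<forall>x\<in>convex hull \<Gamma>. inner a x \<le> b"
    using separating_hyperplane_sets[of "convex hull \<Gamma>" "{p}"] one_mem by auto
  have z0: "z \<noteq> 0" using z by auto
  define u where "u = sgn z"
  define q where "q = inverse (norm z)"
  have q: "0 < q" "q < 1"
    using z z0 by (auto simp: q_def field_simps)
  have u: "u = complex_of_real q * z"
    by (simp add: u_def q_def sgn_eq divide_inverse mult.commute)
  have nu: "norm u = 1"
    using z0 by (simp add: u_def norm_sgn)
  have Imu: "Im u \<noteq> 0"
    using z(3) q by (auto simp: u complex_is_Real_iff)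
  \<comment> \<open>This turns the functional at u ^ m into the real part of a complex geometric
    sequence, whose partial sums have a closed form.\<close>
  define w where "w m = cnj a * u ^ m" for m
  have w_inner: "Re (w m) = inner a (u ^ m)" for m
    by (simp add: w_def inner_complex_def)
  \<comment> \<open>The point z ^ m lies in the half plane; scaling by q ^ m = 1 / |z| ^ m moves it
    to u ^ m and shrinks the bound b geometrically.\<close>
  have w_le: "Re (w m) \<le> b * q ^ m" for m
  proof -
    have "inner a (u ^ m) = q ^ m * inner a (z ^ m)"
      by (simp add: u power_mult_distrib inner_complex_def algebra_simps flip: of_real_power)
    also have "\<dots> \<le> q ^ m * b"
      using ab hull_inc[OF power_mem[OF z(1)]] q by (intro mult_left_mono) auto
    finally show ?thesis by (simp add: w_inner mult.commute)
  qed
  have summable_bq: "summable (\<lambda>m. b * q ^ m)"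
    using q by (intro summable_mult summable_geometric) auto
  have u1: "u \<noteq> 1" using Imu by auto
  have sum_w: "\<bar>\<Sum>m<N. Re (w m)\<bar> \<le> norm a * (2 / norm (u - 1))" for N
  proof -
    have "\<bar>\<Sum>m<N. Re (w m)\<bar> \<le> norm (\<Sum>m<N. w m)"
      by (metis Re_sum abs_Re_le_cmod)
    also have "(\<Sum>m<N. w m) = cnj a * ((u ^ N - 1) / (u - 1))"
      using u1 by (simp add: w_def geometric_sum flip: sum_distrib_left)
    also have "norm \<dots> = norm a * (norm (u ^ N - 1) / norm (u - 1))"
      by (simp add: norm_mult norm_divide)
    also have "\<dots> \<le> norm a * (2 / norm (u - 1))"
      using norm_triangle_ineq4[of "u ^ N" 1] nu
      by (intro mult_left_mono divide_right_mono) (auto simp: norm_power)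
    finally show ?thesis .
  qed
  have "Bseq (\<lambda>n. \<Sum>k\<le>n. b * q ^ k)"
    using summable_bq convergent_imp_Bseq summable_iff_convergent' by blast
  then obtain K where K: "\<And>n. norm (\<Sum>k\<le>n. b * q ^ k) \<le> K"
    unfolding Bseq_def by blast
  (* If \<Gamma> lay in a half plane, the points u ^ m would, up to a summable error, lie in one through 0.
     Their partial sums are bounded, so Re (w m) tends to 0; as u is not real, so does w m. *)
  have "summable (\<lambda>m. b * q ^ m - Re (w m))"
  proof (rule bounded_imp_summable)
    show "0 \<le> b * q ^ m - Re (w m)" for m
      using w_le[of m] by simp
    show "(\<Sum>k\<le>n. b * q ^ k - Re (w k)) \<le> K + norm a * (2 / norm (u - 1))" for n
      using K[of n] sum_w[of "Suc n"]
      by (auto simp: sum_subtractf lessThan_Suc_atMost)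
  qed
  then have "summable (\<lambda>m. b * q ^ m - (b * q ^ m - Re (w m)))"
    by (rule summable_diff[OF summable_bq])
  then have Re0: "(\<lambda>m. Re (w m)) \<longlonglongrightarrow> 0"
    by (simp add: summable_LIMSEQ_zero)
  \<comment> \<open>Since w (m + 1) = u * w m, two consecutive real parts determine the imaginary
    part; the division by Im u requires z to be non-real.\<close>
  have "Im (w m) = (Re u * Re (w m) - Re (w (Suc m))) / Im u" for m
    using Imu by (simp add: w_def field_simps)
  moreover have "(\<lambda>m. (Re u * Re (w m) - Re (w (Suc m))) / Im u) \<longlonglongrightarrow> (Re u * 0 - 0) / Im u"
    using Re0 LIMSEQ_Suc[OF Re0] Imu by (intro tendsto_intros) auto
  ultimately have Im0: "(\<lambda>m. Im (w m)) \<longlonglongrightarrow> 0"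
    by simp
  have "w \<longlonglongrightarrow> 0"
    using Re0 Im0 by (simp add: tendsto_complex_iff)
  then have "(\<lambda>m. norm (w m)) \<longlonglongrightarrow> 0"
    using tendsto_norm_zero by blast
  moreover have "norm (w m) = norm a" for m
    by (simp add: w_def norm_mult norm_power nu)
  ultimately show False
    using a by (simp add: LIMSEQ_const_iff)
qed

text \<open>The two properties may be spread over two elements. If z is real and w is on the circle,
  then z * w is both non-real and off the circle; otherwise z or w itself is. Passing to the inverse
  if necessary makes the norm exceed 1.\<close>

lemma hull_off_circle_nonreal:
  assumes z: "z \<in> \<Gamma>" "norm z \<noteq> 1" and w: "w \<in> \<Gamma>" "w \<notin> \<real>"
  shows "convex hull \<Gamma> = UNIV"
proof -
  have "\<exists>v\<in>\<Gamma>. v \<notin> \<real> \<and> norm v \<noteq> 1"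
  proof (cases "norm w = 1 \<and> z \<in> \<real>")
    case True
    have "z * w \<notin> \<real>"
      using True w z zero_notin
      by (metis Reals_divide nonzero_mult_div_cancel_left)
    moreover have "norm (z * w) \<noteq> 1"
      using True z by (simp add: norm_mult)
    ultimately show ?thesis
      using mult_mem z w by blast
  qed (use z w in blast)
  then obtain v where v: "v \<in> \<Gamma>" "v \<notin> \<real>" "norm v \<noteq> 1" by blast
  have v0: "v \<noteq> 0" using v zero_notin by auto
  show ?thesis
  proof (cases "norm v > 1")
    case True
    then show ?thesis using hull_nonreal v by blast
  next
    case False
    have "norm (inverse v) > 1"
      using False v v0 by (simp add: norm_inverse one_less_inverse_iff)
    moreover have "inverse v \<notin> \<real>"
      using v by (metis Reals_inverse inverse_inverse_eq)
    ultimately show ?thesis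
      using hull_nonreal inverse_mem v by blast
  qed
qed

text \<open>Squaring z or its inverse gives a positive r > 1 in the group, even if z is negative.
  Powers of r and of its inverse then enclose x.\<close>

lemma positive_real_in_hull:
  assumes z: "z \<in> \<Gamma>" "norm z \<noteq> 1" "z \<in> \<real>" and x: "x > 0"
  shows "complex_of_real x \<in> convex hull \<Gamma>"
proof -
  have sq_mem: "of_real ((norm v)\<^sup>2) \<in> \<Gamma>" if "v \<in> \<Gamma>" "v \<in> \<real>" for v
  proof -
    have "of_real ((norm v)\<^sup>2) = v ^ 2"
      using that(2) by (auto elim!: Reals_cases simp flip: of_real_power)
    then show ?thesis using power_mem[OF that(1)] by metis
  qed
  have z0: "z \<noteq> 0" using z zero_notin by auto
  obtain r where r: "r > 1" "of_real r \<in> \<Gamma>"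
  proof (cases "norm z > 1")
    case True
    then show ?thesis
      by (intro that[of "(norm z)\<^sup>2"] sq_mem z) (simp add: one_less_power)
  next
    case False
    have "norm (inverse z) > 1"
      using False z z0 by (simp add: norm_inverse one_less_inverse_iff)
    then show ?thesis
      by (intro that[of "(norm (inverse z))\<^sup>2"] sq_mem inverse_mem Reals_inverse z) (simp add: one_less_power)
  qed
  have r_mem: "of_real (r ^ k) \<in> \<Gamma>" "of_real (inverse (r ^ k)) \<in> \<Gamma>" for k
    using power_mem[OF r(2), of k] inverse_mem[OF power_mem[OF r(2)], of k] by simp_all
  obtain k where k: "x < r ^ k" using real_arch_pow r(1) by blast
  obtain l where l: "inverse x < r ^ l" using real_arch_pow r(1) by blast
  have l': "inverse (r ^ l) < x"
    using l x r by (metis inverse_inverse_eq inverse_less_imp_less inverse_positive_iff_positive less_imp_inverse_less)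
  show ?thesis
    using convex_of_real_between[OF convex_convex_hull hull_inc[OF r_mem(2)] hull_inc[OF r_mem(1)]] k l'
    by (meson less_imp_le)
qed

lemma hull_positive:
  assumes z: "z \<in> \<Gamma>" "norm z \<noteq> 1" and pos: "\<Gamma> \<subseteq> complex_of_real ` {0<..}"
  shows "convex hull \<Gamma> = complex_of_real ` {0<..}"
proof (rule antisym)
  show "convex hull \<Gamma> \<subseteq> complex_of_real ` {0<..}"
    by (intro hull_minimal pos convex_linear_image bounded_linear.linear bounded_linear_of_real convex_real_interval)
  have "z \<in> \<real>" using z pos by auto
  then show "complex_of_real ` {0<..} \<subseteq> convex hull \<Gamma>"
    using positive_real_in_hull[OF z] by auto
qed

lemma hull_real:
  assumes z: "z \<in> \<Gamma>" "norm z \<noteq> 1" and real: "\<Gamma> \<subseteq> \<real>" and npos: "\<not> \<Gamma> \<subseteq> complex_of_real ` {0<..}"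
  shows "convex hull \<Gamma> = \<real>"
proof (rule antisym)
  have "convex (\<real> :: complex set)"
    unfolding Reals_def by (intro convex_linear_image bounded_linear.linear bounded_linear_of_real convex_UNIV)
  then show "convex hull \<Gamma> \<subseteq> \<real>"
    using real by (intro hull_minimal)
  obtain y where y: "y \<in> \<Gamma>" "y \<notin> complex_of_real ` {0<..}"
    using npos by blast
  then obtain s where s': "y = complex_of_real s"
    using real by (auto elim!: Reals_cases)
  then have s: "complex_of_real s \<in> \<Gamma>" "s < 0"
    using y s' zero_notin by (cases s "0::real" rule: linorder_cases; auto)+
  have pos: "complex_of_real x \<in> convex hull \<Gamma>" if "x > 0" for x
    using positive_real_in_hull[OF z] z real that by blast
  have neg: "complex_of_real x \<in> convex hull \<Gamma>" if "x < 0" for x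
  proof -
    \<comment> \<open>Multiplication by the negative group element s maps the hull into itself, and
      a negative x is s times the positive number x / s.\<close>
    have "(*) (complex_of_real s) ` (convex hull \<Gamma>) = convex hull ((*) (complex_of_real s) ` \<Gamma>)"
      by (intro convex_hull_linear_image bounded_linear.linear bounded_linear_mult_right)
    also have "\<dots> \<subseteq> convex hull \<Gamma>"
      using s mult_mem by (intro hull_mono) auto
    finally have "complex_of_real s * complex_of_real (x / s) \<in> convex hull \<Gamma>"
      using pos[of "x / s"] that s by (auto simp: zero_less_divide_iff)
    then show ?thesis using s by simp
  qed
  have "complex_of_real 0 \<in> convex hull \<Gamma>"
    by (rule convex_of_real_between[OF convex_convex_hull neg[of "-1"] pos[of 1]]) auto
  then have "complex_of_real x \<in> convex hull \<Gamma>" for x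
    using pos[of x] neg[of x] by (cases x "0::real" rule: linorder_cases) auto
  then show "\<real> \<subseteq> convex hull \<Gamma>"
    by (auto elim!: Reals_cases)
qed

text \<open>Every element lies on the orbit of its own angle, and the group contains the orbit of
  each of its elements. The element 1 provides \<alpha> = 0, so the union is never empty and covers
  the disc.\<close>

lemma circle_hull_eq_Union_discs:
  assumes "\<Gamma> \<subseteq> sphere 0 1"
  shows "ball 0 1 \<union> \<Gamma> = \<Union> (disc_with_orbit ` {\<alpha>. cis (2 * pi * \<alpha>) \<in> \<Gamma>})"
proof (rule antisym)
  show "ball 0 1 \<union> \<Gamma> \<subseteq> \<Union> (disc_with_orbit ` {\<alpha>. cis (2 * pi * \<alpha>) \<in> \<Gamma>})"
  proof
    fix x assume x: "x \<in> ball 0 1 \<union> \<Gamma>"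
    show "x \<in> \<Union> (disc_with_orbit ` {\<alpha>. cis (2 * pi * \<alpha>) \<in> \<Gamma>})"
    proof (cases "x \<in> ball 0 1")
      case True
      then show ?thesis
        using one_mem by (auto simp: disc_with_orbit_def intro!: exI[of _ 0])
    next
      case False
      define \<alpha> where "\<alpha> = Arg x / (2 * pi)"
      have x\<Gamma>: "x \<in> \<Gamma>" and "norm x = 1" using x False assms by auto
      then have "cis (2 * pi * \<alpha>) = x"
        unfolding \<alpha>_def by (simp add: cis_Arg sgn_eq) (subst cis_Arg, auto simp: sgn_eq)
      moreover have "cis (2 * pi * \<alpha>) \<in> disc_with_orbit \<alpha>"
        by (auto simp: disc_with_orbit_def intro!: rev_image_eqI[of 1])
      ultimately show ?thesis using x\<Gamma> by auto
    qed
  qed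
  show "\<Union> (disc_with_orbit ` {\<alpha>. cis (2 * pi * \<alpha>) \<in> \<Gamma>}) \<subseteq> ball 0 1 \<union> \<Gamma>"
  proof -
    have "cis (2 * pi * \<alpha> * real_of_int m) \<in> \<Gamma>" if "cis (2 * pi * \<alpha>) \<in> \<Gamma>" for \<alpha> m
      using power_int_mem[OF that, of m] by (simp add: cis_power_int mult.commute mult.left_commute)
    then show ?thesis by (auto simp: disc_with_orbit_def)
  qed
qed

lemma hull_Union_hull_types: "\<exists>\<F>\<subseteq>hull_types. convex hull \<Gamma> = \<Union>\<F>"
proof -
  have single: ?thesis if "convex hull \<Gamma> \<in> hull_types"
    using that by (intro exI[of _ "{convex hull \<Gamma>}"]) auto
  consider (fin) "finite \<Gamma>" | (circle) "infinite \<Gamma>" "\<Gamma> \<subseteq> sphere 0 1"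
    | (off) z where "z \<in> \<Gamma>" "norm z \<noteq> 1"
    by (auto simp: subset_iff)
  then show ?thesis
  proof cases
    case fin
    then have "convex hull \<Gamma> = root_polygon (card \<Gamma>)"
      using finite_eq_roots_of_unity by (metis root_polygon_def)
    then show ?thesis
      using finite_eq_roots_of_unity(2)[OF fin] by (intro single) (auto simp: hull_types_def)
  next
    case circle
    then show ?thesis
      using hull_infinite_circle circle_hull_eq_Union_discs
      by (intro exI[of _ "disc_with_orbit ` {\<alpha>. cis (2 * pi * \<alpha>) \<in> \<Gamma>}"]) (auto simp: hull_types_def)
  next
    case off
    then have "convex hull \<Gamma> \<in> {UNIV, \<real>, complex_of_real ` {0<..}}"
      using hull_positive[OF off] hull_real[OF off] hull_off_circle_nonreal[OF off] by blast
    then show ?thesis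
      by (intro single) (auto simp: hull_types_def)
  qed
qed

end

section \<open>Simultaneous triangularization of commuting matrices\<close>

locale alg_closed_vector_space = vector_space scale
  for scale :: "'a :: alg_closed_field \<Rightarrow> 'b :: ab_group_add \<Rightarrow> 'b" (infixr \<open>*\<^sub>F\<close> 75)
begin

text \<open>This is p(T) v. Fixing the vector v avoids building an algebra of operators.\<close>

definition poly_action :: "('b \<Rightarrow> 'b) \<Rightarrow> 'a poly \<Rightarrow> 'b \<Rightarrow> 'b" where
  "poly_action T p v = (\<Sum>i\<le>degree p. coeff p i *\<^sub>F (T ^^ i) v)"

lemma poly_action_bound:
  assumes "degree p \<le> N"
  shows "poly_action T p v = (\<Sum>i\<le>N. coeff p i *\<^sub>F (T ^^ i) v)"
  unfolding poly_action_def
  using assms by (intro sum.mono_neutral_left) (auto simp: coeff_eq_0)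

lemma poly_action_diff: "poly_action T (p - q) v = poly_action T p v - poly_action T q v"
proof -
  define N where "N = max (degree p) (degree q)"
  have "degree (p - q) \<le> N" "degree p \<le> N" "degree q \<le> N"
    by (auto simp: N_def degree_diff_le_max)
  then show ?thesis
    by (simp add: poly_action_bound scale_left_diff_distrib sum_subtractf)
qed

lemma poly_action_smult: "poly_action T (Polynomial.smult c p) v = c *\<^sub>F poly_action T p v"
  by (simp add: poly_action_bound[OF degree_smult_le] poly_action_def scale_sum_right)

lemma poly_action_shift:
  assumes "Vector_Spaces.linear scale scale T"
  shows "poly_action T (pCons 0 p) v = T (poly_action T p v)"
proof -
  interpret T: Vector_Spaces.linear scale scale T by fact
  have "degree (pCons 0 p) \<le> Suc (degree p)"
    by (simp add: degree_pCons_le)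
  then have "poly_action T (pCons 0 p) v = (\<Sum>i\<le>Suc (degree p). coeff (pCons 0 p) i *\<^sub>F (T ^^ i) v)"
    by (rule poly_action_bound)
  also have "\<dots> = (\<Sum>i\<le>degree p. coeff p i *\<^sub>F T ((T ^^ i) v))"
    by (subst sum.atMost_Suc_shift) simp
  also have "\<dots> = T (poly_action T p v)"
    by (simp add: poly_action_def T.sum T.scale)
  finally show ?thesis .
qed

lemma poly_action_linear_factor:
  assumes "Vector_Spaces.linear scale scale T"
  shows "poly_action T ([:- \<mu>, 1:] * p) v = T (poly_action T p v) - \<mu> *\<^sub>F poly_action T p v"
proof -
  have "[:- \<mu>, 1:] * p = pCons 0 p - Polynomial.smult \<mu> p"
    by simp
  then show ?thesis
    by (simp only: poly_action_diff poly_action_smult poly_action_shift[OF assms])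
qed

lemma subspace_poly_action_mem:
  assumes "subspace W" "\<And>w. w \<in> W \<Longrightarrow> T w \<in> W" "v \<in> W"
  shows "poly_action T p v \<in> W"
proof -
  have "(T ^^ i) v \<in> W" for i
    by (induction i) (use assms in auto)
  then show ?thesis
    unfolding poly_action_def by (intro subspace_sum subspace_scale assms(1))
qed

text \<open>The vectors v, T v, ..., T^N v are one more than a spanning set of size N permits to be
  independent; the coefficients of a linear relation among them are those of p.\<close>

lemma annihilating_poly_exists:
  assumes B: "finite B" "W \<subseteq> span B"
    and W: "\<And>w. w \<in> W \<Longrightarrow> T w \<in> W" and v: "v \<in> W"
  obtains p where "p \<noteq> 0" "poly_action T p v = 0"
proof -
  define x where "x i = (T ^^ i) v" for i
  define N where "N = card B"
  have x: "x i \<in> W" for i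
    unfolding x_def by (induction i) (use W v in auto)
  have "\<exists>c. (\<exists>i\<le>N. c i \<noteq> 0) \<and> (\<Sum>i\<le>N. c i *\<^sub>F x i) = 0"
  proof (cases "inj_on x {..N}")
    case True
    have "card (x ` {..N}) = Suc N"
      using card_image[OF True] by simp
    then have "dependent (x ` {..N})"
      using independent_span_bound[OF B(1), of "x ` {..N}"] x B(2) by (force simp: N_def)
    then obtain u where u: "\<exists>w\<in>x ` {..N}. u w \<noteq> 0" "(\<Sum>w\<in>x ` {..N}. u w *\<^sub>F w) = 0"
      by (auto simp: dependent_finite)
    have "(\<Sum>i\<le>N. u (x i) *\<^sub>F x i) = 0"
      using u(2) by (simp add: sum.reindex[OF True])
    then show ?thesis
      using u(1) by (intro exI[of _ "\<lambda>i. u (x i)"]) auto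
  next
    case False
    then obtain i j where ij: "i \<le> N" "j \<le> N" "i \<noteq> j" "x i = x j"
      by (auto simp: inj_on_def)
    \<comment> \<open>\<open>dependent\<close> speaks of sets, so a repetition among the iterates is
      treated separately: x i - x j = 0 is already a nontrivial relation.\<close>
    define c where "c k = (if k = i then 1 else if k = j then - 1 else 0 :: 'a)" for k
    have "(\<Sum>k\<le>N. c k *\<^sub>F x k) = (\<Sum>k\<in>{i, j}. c k *\<^sub>F x k)"
      using ij by (intro sum.mono_neutral_right) (auto simp: c_def)
    also have "\<dots> = 0"
      using ij by (simp add: c_def)
    finally show ?thesis
      using ij by (intro exI[of _ c]) (auto simp: c_def)
  qed
  then obtain c i where c: "i \<le> N" "c i \<noteq> 0" "(\<Sum>i\<le>N. c i *\<^sub>F x i) = 0"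
    by blast
  define p where "p = (\<Sum>i\<le>N. monom (c i) i)"
  have coeff: "coeff p k = (if k \<le> N then c k else 0)" for k
    by (simp add: p_def coeff_sum sum.delta)
  have "degree p \<le> N"
    by (rule degree_le) (simp add: coeff)
  then have "poly_action T p v = 0"
    using c(3) by (simp add: poly_action_bound coeff x_def)
  moreover have "p \<noteq> 0"
    using c(1,2) coeff[of i] by auto
  ultimately show ?thesis
    using that by blast
qed

text \<open>Write p = (X - \<mu>) q with \<mu> a root. Either q(T) v is nonzero, and then it is an
  eigenvector for \<mu>, or q is an annihilating polynomial of smaller degree. The descent cannot
  end at a nonzero constant, as v is nonzero.\<close>

lemma eigenvector_of_annihilating_poly:
  assumes lin: "Vector_Spaces.linear scale scale T"
    and W: "subspace W" "\<And>w. w \<in> W \<Longrightarrow> T w \<in> W" "v \<in> W" "v \<noteq> 0"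
    and "p \<noteq> 0" "poly_action T p v = 0"
  shows "\<exists>u\<in>W. u \<noteq> 0 \<and> (\<exists>\<mu>. T u = \<mu> *\<^sub>F u)"
  using \<open>p \<noteq> 0\<close> \<open>poly_action T p v = 0\<close>
proof (induction "degree p" arbitrary: p)
  case 0
  then show ?case
    using W(4) leading_coeff_0_iff[of p] by (simp add: poly_action_def)
next
  case (Suc d)
  then obtain \<mu> where "poly p \<mu> = 0"
    using alg_closed_imp_poly_has_root[of p] by auto
  then obtain q where q: "p = [:- \<mu>, 1:] * q"
    by (auto simp: poly_eq_0_iff_dvd)
  have q0: "q \<noteq> 0"
    using Suc.prems(1) q by auto
  then have "degree p = Suc (degree q)"
    unfolding q by (subst degree_mult_eq) auto
  then have "degree q = d"
    using Suc.hyps(2) by simp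
  have eig: "T (poly_action T q v) = \<mu> *\<^sub>F poly_action T q v"
    using Suc.prems(2) poly_action_linear_factor[OF lin] by (simp add: q)
  show ?case
  proof (cases "poly_action T q v = 0")
    case True
    then show ?thesis
      using Suc.hyps(1)[of q] q0 \<open>degree q = d\<close> by blast
  next
    case False
    then show ?thesis
      using eig by (intro bexI[OF _ subspace_poly_action_mem[OF W(1-3)]]) auto
  qed
qed

lemma common_eigenvector_exists:
  assumes lin: "\<And>T. T \<in> \<T> \<Longrightarrow> Vector_Spaces.linear scale scale T"
    and comm: "\<And>S T w. S \<in> \<T> \<Longrightarrow> T \<in> \<T> \<Longrightarrow> w \<in> W \<Longrightarrow> S (T w) = T (S w)"
    and W: "subspace W" "\<And>T w. T \<in> \<T> \<Longrightarrow> w \<in> W \<Longrightarrow> T w \<in> W" "\<exists>w\<in>W. w \<noteq> 0"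
    and B: "finite B" "W \<subseteq> span B"
  shows "\<exists>u\<in>W. u \<noteq> 0 \<and> (\<forall>T\<in>\<T>. \<exists>\<mu>. T u = \<mu> *\<^sub>F u)"
proof -
  (* On an invariant subspace of least dimension every T is scalar, because its eigenspaces there are invariant. *)
  define invar where "invar V \<longleftrightarrow> subspace V \<and> V \<subseteq> W \<and> (\<exists>v\<in>V. v \<noteq> 0) \<and> (\<forall>T\<in>\<T>. \<forall>v\<in>V. T v \<in> V)" for V
  have "invar W" using W by (auto simp: invar_def)
  then obtain V where V: "invar V" and V_min: "\<And>V'. invar V' \<Longrightarrow> dim V \<le> dim V'"
    using ex_has_least_nat[of invar W dim] by blast
  \<comment> \<open>Any nonzero vector of V serves. It is fixed before T is chosen and therefore is
    a common eigenvector.\<close>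
  obtain u where u: "u \<in> V" "u \<noteq> 0" using V by (auto simp: invar_def)
  have "\<exists>\<mu>. T u = \<mu> *\<^sub>F u" if T: "T \<in> \<T>" for T
  proof -
    interpret T: Vector_Spaces.linear scale scale T by (rule lin[OF T])
    obtain p where p: "p \<noteq> 0" "poly_action T p u = 0"
      using annihilating_poly_exists[of B V T u] B V T u by (auto simp: invar_def)
    obtain e \<mu> where e: "e \<in> V" "e \<noteq> 0" "T e = \<mu> *\<^sub>F e"
      using eigenvector_of_annihilating_poly[OF lin[OF T] _ _ u p] V T by (auto simp: invar_def)
    define E where "E = {w \<in> V. T w = \<mu> *\<^sub>F w}"
    have "subspace E"
      using V unfolding E_def invar_def subspace_def
      by (auto simp: T.add T.scale scale_right_distrib scale_left_commute)
    moreover have "S w \<in> E" if "S \<in> \<T>" "w \<in> E" for S w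
    proof -
      interpret S: Vector_Spaces.linear scale scale S by (rule lin[OF that(1)])
      have "T (S w) = \<mu> *\<^sub>F S w"
        using that comm[OF T that(1), of w] V by (auto simp: E_def invar_def S.scale)
      then show ?thesis
        using that V by (auto simp: E_def invar_def)
    qed
    ultimately have "invar E"
      using V e by (auto simp: invar_def E_def)
    obtain C where C: "C \<subseteq> E" "independent C" "E \<subseteq> span C" "card C = dim E"
      using basis_exists by blast
    \<comment> \<open>The finite spanning set \<open>B\<close> bounds all independent sets in V, so
      that \<open>dim\<close> and \<open>card\<close> can be compared.\<close>
    have fin: "finite D \<and> card D \<le> dim V" if D: "D \<subseteq> V" "independent D" for D
    proof -
      obtain C' where C': "C' \<subseteq> V" "independent C'" "V \<subseteq> span C'" "card C' = dim V"
        using basis_exists by blast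
      then have "finite C'"
        using independent_span_bound[OF B(1), of C'] B V by (auto simp: invar_def)
      then show ?thesis
        using independent_span_bound[of C' D] D C' by auto
    qed
    \<comment> \<open>Otherwise a basis of E extended by u would be independent in V, so E would be
      an invariant subspace of smaller dimension.\<close>
    have "u \<in> span C"
    proof (rule ccontr)
      assume nspan: "u \<notin> span C"
      then have "independent (insert u C)"
        using C(2) by (simp add: independent_insert)
      moreover have "C \<subseteq> V" using C(1) by (auto simp: E_def)
      ultimately have "finite C" "card (insert u C) \<le> dim V"
        using fin[of "insert u C"] fin[of C] u C(2) by auto
      moreover have "u \<notin> C" using nspan span_base by blast
      ultimately have "Suc (card C) \<le> dim V" by simp
      then show False
        using V_min[OF \<open>invar E\<close>] C(4) by linarith
    qed
    moreover have "span C \<subseteq> E"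
      using C(1) \<open>subspace E\<close> by (rule span_minimal)
    ultimately show ?thesis by (auto simp: E_def)
  qed
  then show ?thesis
    using u V by (auto simp: invar_def)
qed

end

text \<open>The abstract result is transported to matrices: functions on the naturals that vanish
  from n on model the column vectors, and \<open>T M\<close> models multiplication by M.\<close>

lemma commuting_mats_common_eigenvector:
  fixes S :: "'a :: alg_closed_field mat set"
  assumes S: "S \<subseteq> carrier_mat n n" and comm: "\<And>M N. M \<in> S \<Longrightarrow> N \<in> S \<Longrightarrow> M * N = N * M" and "n > 0"
  obtains v where "v \<in> carrier_vec n" "v \<noteq> 0\<^sub>v n" "\<And>M. M \<in> S \<Longrightarrow> \<exists>\<mu>. M *\<^sub>v v = \<mu> \<cdot>\<^sub>v v"
proof -
  define sc where "sc c f = (\<lambda>i. c * f i)" for c :: 'a and f :: "nat \<Rightarrow> 'a"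
  interpret alg_closed_vector_space sc
    by unfold_locales (auto simp: sc_def fun_eq_iff algebra_simps)
  \<comment> \<open>The default value 0 beyond n puts every image in \<open>W\<close>.\<close>
  define T where "T M f = (\<lambda>i. if i < n then (M *\<^sub>v vec n f) $ i else 0)" for M :: "'a mat" and f :: "nat \<Rightarrow> 'a"
  define W where "W = {f :: nat \<Rightarrow> 'a. \<forall>i\<ge>n. f i = 0}"
  define unit where "unit k = (\<lambda>i. if i = k then 1 else 0 :: 'a)" for k :: nat
  have vec_T: "vec n (T M f) = M *\<^sub>v vec n f" if "M \<in> S" for M f
    using that S by (intro eq_vecI) (auto simp: T_def)
  have "\<exists>u\<in>W. u \<noteq> 0 \<and> (\<forall>F\<in>T ` S. \<exists>\<mu>. F u = sc \<mu> u)"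
  proof (rule common_eigenvector_exists)
    show "Vector_Spaces.linear sc sc F" if F: "F \<in> T ` S" for F
    proof -
      obtain M where M: "M \<in> carrier_mat n n" "F = T M" using F S by auto
      have "T M (f + g) = T M f + T M g" for f g
      proof -
        have "vec n (f + g) = vec n f + vec n g" by auto
        then show ?thesis
          using M by (auto simp: T_def fun_eq_iff mult_add_distrib_mat_vec[OF M(1)])
      qed
      moreover have "T M (sc c f) = sc c (T M f)" for c f
      proof -
        have "vec n (sc c f) = c \<cdot>\<^sub>v vec n f" by (auto simp: sc_def)
        then show ?thesis
          using M by (auto simp: T_def sc_def fun_eq_iff mult_mat_vec[OF M(1)])
      qed
      ultimately show ?thesis
        unfolding M by unfold_locales
    qed
    show "F (G w) = G (F w)" if FG: "F \<in> T ` S" "G \<in> T ` S" for F G w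
    proof -
      obtain M N where MN: "M \<in> S" "F = T M" "N \<in> S" "G = T N" using FG by auto
      have "M \<in> carrier_mat n n" "N \<in> carrier_mat n n"
        using MN S by auto
      then have "M *\<^sub>v (N *\<^sub>v vec n w) = N *\<^sub>v (M *\<^sub>v vec n w)"
        using comm[OF MN(1,3)] assoc_mult_mat_vec[of M n n N n "vec n w"] assoc_mult_mat_vec[of N n n M n "vec n w"]
        by auto
      then show ?thesis
        unfolding MN T_def[of M "T N w"] T_def[of N "T M w"] by (simp add: vec_T MN cong: if_cong)
    qed
    show "subspace W"
      by (auto simp: subspace_def W_def sc_def)
    show "F w \<in> W" if "F \<in> T ` S" for F w
      using that by (auto simp: W_def T_def)
    show "\<exists>w\<in>W. w \<noteq> 0"
      using \<open>n > 0\<close> by (intro bexI[of _ "unit 0"]) (auto simp: W_def unit_def fun_eq_iff)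
    show "finite (unit ` {..<n})" by simp
    show "W \<subseteq> span (unit ` {..<n})"
    proof
      fix f assume f: "f \<in> W"
      have "f = (\<Sum>k<n. sc (f k) (unit k))"
      proof
        fix i
        have eval: "(\<Sum>k\<in>A. g k) i = (\<Sum>k\<in>A. g k i)" if "finite A" for A and g :: "nat \<Rightarrow> nat \<Rightarrow> 'a"
          using that by induction auto
        show "f i = (\<Sum>k<n. sc (f k) (unit k)) i"
          using f by (auto simp: eval sc_def unit_def W_def if_distrib[of "\<lambda>x. _ * x"] cong: if_cong)
      qed
      moreover have "(\<Sum>k<n. sc (f k) (unit k)) \<in> span (unit ` {..<n})"
        by (intro span_sum span_scale span_base) auto
      ultimately show "f \<in> span (unit ` {..<n})" by simp
    qed
  qed
  then obtain u where u: "u \<in> W" "u \<noteq> 0" "\<And>M. M \<in> S \<Longrightarrow> \<exists>\<mu>. T M u = sc \<mu> u" by blast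
  show ?thesis
  proof (rule that)
    show "vec n u \<in> carrier_vec n" by simp
    obtain i where i: "u i \<noteq> 0" using u(2) by (auto simp: fun_eq_iff)
    have "i < n"
      by (rule ccontr) (use u(1) i in \<open>auto simp: W_def\<close>)
    with i have "vec n u $ i \<noteq> 0\<^sub>v n $ i" by simp
    then show "vec n u \<noteq> 0\<^sub>v n" by metis
    show "\<exists>\<mu>. M *\<^sub>v vec n u = \<mu> \<cdot>\<^sub>v vec n u" if M: "M \<in> S" for M
    proof -
      obtain \<mu> where "T M u = sc \<mu> u" using u(3)[OF M] by blast
      then have "M *\<^sub>v vec n u = vec n (sc \<mu> u)" by (simp flip: vec_T[OF M])
      also have "\<dots> = \<mu> \<cdot>\<^sub>v vec n u" by (auto simp: sc_def)
      finally show ?thesis by blast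
    qed
  qed
qed

section \<open>Splitting off a common eigenvector by block matrices\<close>

lemma adapted_basis_exists:
  fixes v :: "'a :: conjugatable_ordered_field vec"
  assumes v: "v \<in> carrier_vec n" "v \<noteq> 0\<^sub>v n" and n: "n \<noteq> 0"
  obtains P Q where "P \<in> carrier_mat n n" "Q \<in> carrier_mat n n" "P * Q = 1\<^sub>m n" "Q * P = 1\<^sub>m n"
    "\<And>A e. A \<in> carrier_mat n n \<Longrightarrow> A *\<^sub>v v = e \<cdot>\<^sub>v v \<Longrightarrow> col (Q * A * P) 0 = vec n (\<lambda>i. if i = 0 then e else 0)"
proof -
  interpret cof_vec_space n "TYPE('a)" .
  \<comment> \<open>Gram-Schmidt keeps the first vector v of the completed basis, so v is the first
    column of \<open>P\<close>. The pair depends on v alone and thus serves all matrices with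
    eigenvector v at once.\<close>
  define b where "b = basis_completion v"
  define ws where "ws = gram_schmidt n b"
  define P where "P = mat_of_cols n ws"
  define Q where "Q = corthogonal_inv P"
  note b = basis_completion[OF v, folded b_def]
  obtain vs where bv: "b = v # vs" using b(6,7) n by (cases b) auto
  from gram_schmidt_result[OF b(2) b(4) b(5) refl, folded ws_def] b(6)
  have ws: "set ws \<subseteq> carrier_vec n" "corthogonal ws" "length ws = n" by auto
  have hdws: "hd ws = v"
    using gram_schmidt_hd[OF v(1), of vs] by (simp add: ws_def bv)
  have P: "P \<in> carrier_mat n n"
    using ws mat_of_cols_carrier(1)[of n ws] by (simp add: P_def)
  then have Q: "Q \<in> carrier_mat n n"
    by (auto simp: Q_def corthogonal_inv_def mat_of_rows_def)
  have "inverts_mat Q P"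
    unfolding Q_def P_def by (intro corthogonal_inv_result orthogonal_mat_of_cols ws)
  then have QP: "Q * P = 1\<^sub>m n" using P Q by (auto simp: inverts_mat_def)
  then have PQ: "P * Q = 1\<^sub>m n" by (rule mat_mult_left_right_inverse[OF Q P])
  show ?thesis
    using that[OF P Q PQ QP] corthogonal_col_ev_0[OF _ v _ n hdws ws] by (simp add: P_def Q_def)
qed

lemma four_block_of_first_col:
  fixes A :: "'a :: zero mat"
  assumes A: "A \<in> carrier_mat (Suc m) (Suc m)" and "col A 0 = vec (Suc m) (\<lambda>i. if i = 0 then e else 0)"
  shows "A = four_block_mat (mat 1 1 (\<lambda>_. e)) (mat 1 m (\<lambda>(i, j). A $$ (0, Suc j)))
    (0\<^sub>m m 1) (mat m m (\<lambda>(i, j). A $$ (Suc i, Suc j)))"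
proof (rule eq_matI)
  have col: "A $$ (i, 0) = (if i = 0 then e else 0)" if "i < Suc m" for i
    using that A arg_cong[OF assms(2), of "\<lambda>v. v $ i"] by auto
  show "A $$ (i, j) = four_block_mat (mat 1 1 (\<lambda>_. e)) (mat 1 m (\<lambda>(i, j). A $$ (0, Suc j)))
    (0\<^sub>m m 1) (mat m m (\<lambda>(i, j). A $$ (Suc i, Suc j))) $$ (i, j)"
    if "i < dim_row (four_block_mat (mat 1 1 (\<lambda>_. e)) (mat 1 m (\<lambda>(i, j). A $$ (0, Suc j)))
      (0\<^sub>m m 1) (mat m m (\<lambda>(i, j). A $$ (Suc i, Suc j))))"
      "j < dim_col (four_block_mat (mat 1 1 (\<lambda>_. e)) (mat 1 m (\<lambda>(i, j). A $$ (0, Suc j)))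
      (0\<^sub>m m 1) (mat m m (\<lambda>(i, j). A $$ (Suc i, Suc j))))" for i j
    using that col[of i] by (cases i; cases j) auto
qed (use A in auto)

lemma four_block_conjugate:
  fixes a :: "'a :: comm_ring_1 mat"
  assumes a: "a \<in> carrier_mat k k" and b: "b \<in> carrier_mat k m" and c: "c \<in> carrier_mat m m"
    and X: "X \<in> carrier_mat m m" and Y: "Y \<in> carrier_mat m m"
  shows "four_block_mat (1\<^sub>m k) (0\<^sub>m k m) (0\<^sub>m m k) X * four_block_mat a b (0\<^sub>m m k) c *
    four_block_mat (1\<^sub>m k) (0\<^sub>m k m) (0\<^sub>m m k) Y = four_block_mat a (b * Y) (0\<^sub>m m k) (X * c * Y)"
proof -
  have Xc: "X * c \<in> carrier_mat m m" using X c by (rule mult_carrier_mat)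
  have bY: "b * Y \<in> carrier_mat k m" using b Y by (rule mult_carrier_mat)
  have XcY: "X * c * Y \<in> carrier_mat m m" using Xc Y by (rule mult_carrier_mat)
  have "four_block_mat (1\<^sub>m k) (0\<^sub>m k m) (0\<^sub>m m k) X * four_block_mat a b (0\<^sub>m m k) c
      = four_block_mat a b (0\<^sub>m m k) (X * c)"
    using a b c X Xc by (simp add: mult_four_block_mat[of _ k k _ m _ m _ _ k _ m])
  moreover have "four_block_mat a b (0\<^sub>m m k) (X * c) * four_block_mat (1\<^sub>m k) (0\<^sub>m k m) (0\<^sub>m m k) Y
      = four_block_mat a (b * Y) (0\<^sub>m m k) (X * c * Y)"
    using a b Y Xc bY XcY right_mult_zero_mat[OF Xc, of k] by (simp add: mult_four_block_mat[of _ k k _ m _ m _ _ k _ m])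
  ultimately show ?thesis by simp
qed

text \<open>Induction on the size. In a basis starting with a common eigenvector all matrices become
  block triangular with a 1-by-1 block in front, and the remaining blocks of size m again
  commute.\<close>

lemma simultaneous_triangularization:
  fixes S :: "complex mat set"
  assumes "S \<subseteq> carrier_mat n n" "\<And>M N. M \<in> S \<Longrightarrow> N \<in> S \<Longrightarrow> M * N = N * M"
  shows "\<exists>P Q. P \<in> carrier_mat n n \<and> Q \<in> carrier_mat n n \<and> P * Q = 1\<^sub>m n \<and> Q * P = 1\<^sub>m n \<and>
    (\<forall>M\<in>S. upper_triangular (Q * M * P))"
  using assms
proof (induction n arbitrary: S)
  case 0
  then have "upper_triangular (1\<^sub>m 0 * M * 1\<^sub>m 0)" if "M \<in> S" for M
    using that by (auto intro!: upper_triangularI)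
  then show ?case
    by (intro exI[of _ "1\<^sub>m 0"]) auto
next
  case (Suc m)
  let ?n = "Suc m"
  obtain v where v: "v \<in> carrier_vec ?n" "v \<noteq> 0\<^sub>v ?n"
    and ev: "\<And>M. M \<in> S \<Longrightarrow> \<exists>\<mu>. M *\<^sub>v v = \<mu> \<cdot>\<^sub>v v"
    using commuting_mats_common_eigenvector[OF Suc.prems] by auto
  obtain P Q where P: "P \<in> carrier_mat ?n ?n" and Q: "Q \<in> carrier_mat ?n ?n"
    and PQ: "P * Q = 1\<^sub>m ?n" and QP: "Q * P = 1\<^sub>m ?n"
    and col0: "\<And>A e. A \<in> carrier_mat ?n ?n \<Longrightarrow> A *\<^sub>v v = e \<cdot>\<^sub>v v \<Longrightarrow>
      col (Q * A * P) 0 = vec ?n (\<lambda>i. if i = 0 then e else 0)"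
    using adapted_basis_exists[OF v] by auto
  define A1 where "A1 e = mat 1 1 (\<lambda>_. e)" for e :: complex
  define A2 where "A2 M = mat 1 m (\<lambda>(i, j). (Q * M * P) $$ (0, Suc j))" for M
  define A3 where "A3 M = mat m m (\<lambda>(i, j). (Q * M * P) $$ (Suc i, Suc j))" for M
  have car: "\<And>e. A1 e \<in> carrier_mat 1 1" "\<And>M. A2 M \<in> carrier_mat 1 m" "\<And>M. A3 M \<in> carrier_mat m m"
    by (simp_all add: A1_def A2_def A3_def)
  have block: "\<exists>e. Q * M * P = four_block_mat (A1 e) (A2 M) (0\<^sub>m m 1) (A3 M)" if M: "M \<in> S" for M
  proof -
    obtain e where "M *\<^sub>v v = e \<cdot>\<^sub>v v" using ev[OF M] by blast
    then have "col (Q * M * P) 0 = vec ?n (\<lambda>i. if i = 0 then e else 0)"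
      using Suc.prems(1) M by (intro col0) auto
    moreover have "Q * M * P \<in> carrier_mat ?n ?n"
      using P Q Suc.prems(1) M by (meson mult_carrier_mat subsetD)
    ultimately show ?thesis
      using four_block_of_first_col[of "Q * M * P" m e] unfolding A1_def A2_def A3_def by blast
  qed
  have conj_mult: "(Q * M * P) * (Q * N * P) = Q * (M * N) * P" if "M \<in> S" "N \<in> S" for M N
  proof -
    have M: "M \<in> carrier_mat ?n ?n" and N: "N \<in> carrier_mat ?n ?n" using that Suc.prems(1) by auto
    have "(Q * M * P) * (Q * N * P) = Q * M * (P * Q) * N * P"
      using M N P Q by (simp add: assoc_mult_mat[of _ ?n ?n _ ?n _ ?n])
    also have "\<dots> = Q * (M * N) * P"
      using M N P Q by (simp add: PQ assoc_mult_mat[of _ ?n ?n _ ?n _ ?n])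
    finally show ?thesis .
  qed
  \<comment> \<open>Because the lower left blocks vanish, the lower right block of a product is the
    product of the lower right blocks; commutation is thereby inherited.\<close>
  have A3_mult: "\<exists>e b. Q * (M * N) * P = four_block_mat e b (0\<^sub>m m 1) (A3 M * A3 N) \<and>
      e \<in> carrier_mat 1 1 \<and> b \<in> carrier_mat 1 m" if MN: "M \<in> S" "N \<in> S" for M N
  proof -
    obtain e f where "Q * M * P = four_block_mat (A1 e) (A2 M) (0\<^sub>m m 1) (A3 M)"
      "Q * N * P = four_block_mat (A1 f) (A2 N) (0\<^sub>m m 1) (A3 N)"
      using block MN by blast
    then have "Q * (M * N) * P = four_block_mat (A1 e * A1 f + A2 M * 0\<^sub>m m 1) (A1 e * A2 N + A2 M * A3 N)
        (0\<^sub>m m 1 * A1 f + A3 M * 0\<^sub>m m 1) (0\<^sub>m m 1 * A2 N + A3 M * A3 N)"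
      using car by (simp only: conj_mult[OF MN, symmetric] mult_four_block_mat[of _ 1 1 _ m _ m _ _ 1 _ m] zero_carrier_mat)
    moreover have "0\<^sub>m m 1 * A1 f + A3 M * 0\<^sub>m m 1 = 0\<^sub>m m 1"
      by (simp only: left_mult_zero_mat[OF car(1)] right_mult_zero_mat[OF car(3)] left_add_zero_mat[OF zero_carrier_mat])
    moreover have "0\<^sub>m m 1 * A2 N + A3 M * A3 N = A3 M * A3 N"
      by (simp only: left_mult_zero_mat[OF car(2)] left_add_zero_mat[OF mult_carrier_mat[OF car(3) car(3)]])
    ultimately show ?thesis
      using car by (metis add_carrier_mat mult_carrier_mat zero_carrier_mat)
  qed
  have A3_comm: "A3 M * A3 N = A3 N * A3 M" if MN: "M \<in> S" "N \<in> S" for M N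
  proof -
    obtain e b where 1: "Q * (M * N) * P = four_block_mat e b (0\<^sub>m m 1) (A3 M * A3 N)"
      "e \<in> carrier_mat 1 1" "b \<in> carrier_mat 1 m" using A3_mult[OF MN] by blast
    obtain f c where 2: "Q * (N * M) * P = four_block_mat f c (0\<^sub>m m 1) (A3 N * A3 M)"
      "f \<in> carrier_mat 1 1" "c \<in> carrier_mat 1 m" using A3_mult[OF MN(2,1)] by blast
    have eq: "four_block_mat e b (0\<^sub>m m 1) (A3 M * A3 N) = four_block_mat f c (0\<^sub>m m 1) (A3 N * A3 M)"
      using 1 2 Suc.prems(2)[OF MN] by simp
    have entry: "four_block_mat x y (0\<^sub>m m 1) X $$ (Suc i, Suc j) = X $$ (i, j)"
      if "x \<in> carrier_mat 1 1" "X \<in> carrier_mat m m" "i < m" "j < m" for x y X i j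
      using that by auto
    have X: "A3 M * A3 N \<in> carrier_mat m m" "A3 N * A3 M \<in> carrier_mat m m"
      using car(3) by (meson mult_carrier_mat)+
    show ?thesis
    proof (rule eq_matI)
      fix i j assume "i < dim_row (A3 N * A3 M)" "j < dim_col (A3 N * A3 M)"
      then show "(A3 M * A3 N) $$ (i, j) = (A3 N * A3 M) $$ (i, j)"
        using entry[OF 1(2) X(1), of i j b] entry[OF 2(2) X(2), of i j c] eq X(2) by (metis carrier_matD)
    qed (use X in \<open>simp_all only: carrier_matD\<close>)
  qed
  have "\<exists>P Q. P \<in> carrier_mat m m \<and> Q \<in> carrier_mat m m \<and> P * Q = 1\<^sub>m m \<and> Q * P = 1\<^sub>m m \<and>
    (\<forall>M\<in>A3 ` S. upper_triangular (Q * M * P))"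
    using car A3_comm by (intro Suc.IH) auto
  then obtain P' Q' where P': "P' \<in> carrier_mat m m" and Q': "Q' \<in> carrier_mat m m"
    and PQ': "P' * Q' = 1\<^sub>m m" and QP': "Q' * P' = 1\<^sub>m m"
    and ut: "\<And>M. M \<in> S \<Longrightarrow> upper_triangular (Q' * A3 M * P')" by auto
  \<comment> \<open>A base change in dimension m is extended by fixing the first basis vector, which
    keeps the zeros already produced.\<close>
  define E where "E X = four_block_mat (1\<^sub>m 1) (0\<^sub>m 1 m) (0\<^sub>m m 1) X" for X :: "complex mat"
  have E: "E X \<in> carrier_mat ?n ?n" if "X \<in> carrier_mat m m" for X
    using that by (auto simp: E_def)
  have E_mult: "E X * E Y = E (X * Y)" if "X \<in> carrier_mat m m" "Y \<in> carrier_mat m m" for X Y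
    using that by (auto simp: E_def mult_four_block_mat[of _ 1 1 _ m _ m _ _ 1 _ m])
  have E_one: "E (1\<^sub>m m) = 1\<^sub>m ?n" by (simp add: E_def)
  have inv: "(X * E X') * (E Y' * Y) = 1\<^sub>m ?n"
    if "X \<in> carrier_mat ?n ?n" "Y \<in> carrier_mat ?n ?n" "X * Y = 1\<^sub>m ?n"
      "X' \<in> carrier_mat m m" "Y' \<in> carrier_mat m m" "X' * Y' = 1\<^sub>m m" for X Y X' Y'
  proof -
    have "(X * E X') * (E Y' * Y) = X * (E X' * E Y') * Y"
      using that E[OF that(4)] E[OF that(5)] by (simp add: assoc_mult_mat[of _ ?n ?n _ ?n _ ?n])
    then show ?thesis using that by (simp add: E_mult E_one)
  qed
  have "upper_triangular ((E Q' * Q) * M * (P * E P'))" if M: "M \<in> S" for M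
  proof -
    obtain e where e: "Q * M * P = four_block_mat (A1 e) (A2 M) (0\<^sub>m m 1) (A3 M)"
      using block[OF M] by blast
    have "M \<in> carrier_mat ?n ?n" "Q * M * P \<in> carrier_mat ?n ?n"
      using M Suc.prems(1) P Q by (meson mult_carrier_mat subsetD)+
    then have "(E Q' * Q) * M * (P * E P') = E Q' * (Q * M * P) * E P'"
      using P Q E[OF P'] E[OF Q'] by (simp add: assoc_mult_mat[of _ ?n ?n _ ?n _ ?n])
    also have "\<dots> = four_block_mat (A1 e) (A2 M * P') (0\<^sub>m m 1) (Q' * A3 M * P')"
      unfolding e E_def by (rule four_block_conjugate[OF car Q' P'])
    finally show ?thesis
      using car P' Q' ut[OF M]
      by (auto intro!: upper_triangular_four_block simp: A1_def)
  qed
  moreover have "(P * E P') * (E Q' * Q) = 1\<^sub>m ?n"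
    using inv P Q PQ P' Q' PQ' by blast
  moreover have "(E Q' * Q) * (P * E P') = 1\<^sub>m ?n"
    using P Q E[OF P'] E[OF Q'] calculation by (intro mat_mult_left_right_inverse[of "P * E P'"]) auto
  ultimately show ?case
    using P Q E[OF P'] E[OF Q'] by (intro exI[of _ "P * E P'"] exI[of _ "E Q' * Q"]) auto
qed

section \<open>Products, inverses and characteristic polynomials of upper triangular
  matrices\<close>

lemma index_mult_upper_triangular_diag:
  fixes A B :: "'a :: semiring_0 mat"
  assumes A: "A \<in> carrier_mat n n" "upper_triangular A" and B: "B \<in> carrier_mat n n" "upper_triangular B"
    and j: "j < n"
  shows "(A * B) $$ (j, j) = A $$ (j, j) * B $$ (j, j)"
proof -
  have "(A * B) $$ (j, j) = (\<Sum>k = 0..<n. A $$ (j, k) * B $$ (k, j))"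
    using A B j by (simp add: scalar_prod_def)
  also have "\<dots> = (\<Sum>k \<in> {j}. A $$ (j, k) * B $$ (k, j))"
  proof (rule sum.mono_neutral_right)
    show "\<forall>k\<in>{0..<n} - {j}. A $$ (j, k) * B $$ (k, j) = 0"
    proof
      fix k assume k: "k \<in> {0..<n} - {j}"
      show "A $$ (j, k) * B $$ (k, j) = 0"
        using k j A B upper_triangularD[of A k j] upper_triangularD[of B j k] by (cases k j rule: linorder_cases) auto
    qed
  qed (use j in auto)
  finally show ?thesis by simp
qed

lemma upper_triangular_mult:
  fixes A B :: "'a :: semiring_0 mat"
  assumes A: "A \<in> carrier_mat n n" "upper_triangular A" and B: "B \<in> carrier_mat n n" "upper_triangular B"
  shows "upper_triangular (A * B)"
proof (rule upper_triangularI)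
  fix i j assume ij: "j < i" "i < dim_row (A * B)"
  have "(A * B) $$ (i, j) = (\<Sum>k = 0..<n. A $$ (i, k) * B $$ (k, j))"
    using A B ij by (simp add: scalar_prod_def)
  also have "\<dots> = 0"
  proof (rule sum.neutral, rule ballI)
    fix k assume "k \<in> {0..<n}"
    then show "A $$ (i, k) * B $$ (k, j) = 0"
      using ij A B upper_triangularD[of A k i] upper_triangularD[of B j k] by (cases "k < i") auto
  qed
  finally show "(A * B) $$ (i, j) = 0" .
qed

text \<open>Below the diagonal the entries of B * A are 0. By induction over the columns of B and by
  triangularity of A, only B(i, j) * A(j, j) survives in such an entry, and A(j, j) is nonzero since
  A is invertible.\<close>

lemma upper_triangular_inverse:
  fixes A B :: "'a :: field mat"
  assumes A: "A \<in> carrier_mat n n" "upper_triangular A" and B: "B \<in> carrier_mat n n"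
    and AB: "A * B = 1\<^sub>m n" and BA: "B * A = 1\<^sub>m n"
  shows "upper_triangular B"
proof (rule upper_triangularI)
  have "det A \<noteq> 0"
    using det_mult[OF A(1) B] AB by auto
  then have diag: "A $$ (j, j) \<noteq> 0" if "j < n" for j
    using upper_triangular_imp_det_eq_0_iff[OF A] that A(1) by (auto simp: diag_mat_def image_iff)
  fix i j assume "j < i" "i < dim_row B"
  then show "B $$ (i, j) = 0"
  proof (induction j rule: less_induct)
    case (less j)
    have ij: "i < n" "j < n" "i \<noteq> j" using less.prems B by auto
    have "0 = (B * A) $$ (i, j)"
      using ij by (simp add: BA)
    also have "\<dots> = (\<Sum>k = 0..<n. B $$ (i, k) * A $$ (k, j))"
      using ij A B by (simp add: scalar_prod_def)
    also have "\<dots> = (\<Sum>k \<in> {j}. B $$ (i, k) * A $$ (k, j))"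
    proof (rule sum.mono_neutral_right)
      show "\<forall>k\<in>{0..<n} - {j}. B $$ (i, k) * A $$ (k, j) = 0"
      proof
        fix k assume k: "k \<in> {0..<n} - {j}"
        show "B $$ (i, k) * A $$ (k, j) = 0"
        proof (cases "k < j")
          case True
          then show ?thesis using less by simp
        next
          case False
          then show ?thesis using k A upper_triangularD[of A j k] by auto
        qed
      qed
    qed (use ij in auto)
    finally show ?case using diag[OF ij(2)] by simp
  qed
qed

lemma upper_triangular_char_poly:
  assumes "A \<in> carrier_mat n n" "upper_triangular A"
  shows "char_poly A = (\<Prod>j<n. [:- A $$ (j, j), 1:])"
proof -
  have "char_poly A = (\<Prod>a\<leftarrow>diag_mat A. [:- a, 1:])"
    using assms by (intro char_poly_upper_triangular)
  also have "\<dots> = (\<Prod>j\<leftarrow>[0..<n]. [:- A $$ (j, j), 1:])"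
    using assms(1) by (simp add: diag_mat_def comp_def)
  also have "\<dots> = (\<Prod>j<n. [:- A $$ (j, j), 1:])"
    by (subst prod.distinct_set_conv_list[symmetric]) (auto simp: atLeast0LessThan)
  finally show ?thesis .
qed

section \<open>Hull spectra of triangularizable groups\<close>

lemma GL_mult: "x \<otimes>\<^bsub>GL n\<^esub> y = x * y"
  by (simp add: GL_def units_of_mult ring_mat_simps)

lemma GL_one: "\<one>\<^bsub>GL n\<^esub> = 1\<^sub>m n"
  by (simp add: GL_def units_of_one ring_mat_simps)

lemma GL_carrier: "carrier (GL n) = {M \<in> carrier_mat n n. \<exists>N\<in>carrier_mat n n. N * M = 1\<^sub>m n \<and> M * N = 1\<^sub>m n}"
  by (simp add: GL_def units_of_carrier Units_def ring_mat_simps)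

lemma GL_group: "group (GL n)"
proof -
  interpret ring "ring_mat TYPE(complex) n ()" by (rule ring_mat)
  show ?thesis unfolding GL_def by (rule units_group)
qed

lemma scalar_mat_mult: "scalar_mat x * scalar_mat y = scalar_mat (x * y)"
  by (rule eq_matI) (auto simp: scalar_mat_def scalar_prod_def)

lemma scalar_mat_one: "scalar_mat 1 = 1\<^sub>m 1"
  by (rule eq_matI) (auto simp: scalar_mat_def)

lemma scalar_mat_carrier: "scalar_mat x \<in> carrier_mat 1 1"
  by (simp add: scalar_mat_def)

lemma scalar_mat_GL:
  assumes "x \<noteq> 0"
  shows "scalar_mat x \<in> carrier (GL 1)"
proof -
  have "scalar_mat (inverse x) * scalar_mat x = 1\<^sub>m 1" "scalar_mat x * scalar_mat (inverse x) = 1\<^sub>m 1"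
    using assms by (simp_all add: scalar_mat_mult scalar_mat_one)
  then show ?thesis
    unfolding GL_carrier using scalar_mat_carrier by blast
qed

text \<open>Conjugation is kept apart from the group because several pairs occur: the one from
  simultaneous triangularization, the one supplied with joint eigenvalues, and identity
  matrices.\<close>

locale inverse_mats =
  fixes n :: nat and P Q :: "complex mat"
  assumes P: "P \<in> carrier_mat n n" and Q: "Q \<in> carrier_mat n n"
    and PQ: "P * Q = 1\<^sub>m n" and QP: "Q * P = 1\<^sub>m n"
begin

definition conj_mat :: "complex mat \<Rightarrow> complex mat" where
  "conj_mat M = Q * M * P"

lemma conj_mat_carrier: "M \<in> carrier_mat n n \<Longrightarrow> conj_mat M \<in> carrier_mat n n"
  unfolding conj_mat_def using P Q by (meson mult_carrier_mat)

lemma conj_mat_one: "conj_mat (1\<^sub>m n) = 1\<^sub>m n"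
  using P Q QP by (simp add: conj_mat_def)

lemma conj_mat_mult:
  assumes "M \<in> carrier_mat n n" "N \<in> carrier_mat n n"
  shows "conj_mat (M * N) = conj_mat M * conj_mat N"
proof -
  have "conj_mat M * conj_mat N = Q * M * (P * Q) * N * P"
    using assms P Q by (simp add: conj_mat_def assoc_mult_mat[of _ n n _ n _ n])
  also have "\<dots> = conj_mat (M * N)"
    using assms P Q by (simp add: conj_mat_def PQ assoc_mult_mat[of _ n n _ n _ n])
  finally show ?thesis ..
qed

lemma similar_conj_mat:
  assumes "M \<in> carrier_mat n n"
  shows "similar_mat_wit M (conj_mat M) P Q"
proof (rule similar_mat_witI[OF PQ QP _ assms conj_mat_carrier[OF assms] P Q])
  have "P * conj_mat M * Q = (P * Q) * M * (P * Q)"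
    using assms P Q by (simp add: conj_mat_def assoc_mult_mat[of _ n n _ n _ n])
  then show "M = P * conj_mat M * Q"
    using assms by (simp add: PQ)
qed

lemma char_poly_conj_mat:
  assumes "M \<in> carrier_mat n n" "upper_triangular (conj_mat M)"
  shows "char_poly M = (\<Prod>j<n. [:- conj_mat M $$ (j, j), 1:])"
proof -
  have "char_poly M = char_poly (conj_mat M)"
    using similar_conj_mat[OF assms(1)] by (intro char_poly_similar) (auto simp: similar_mat_def)
  then show ?thesis
    using upper_triangular_char_poly[OF conj_mat_carrier[OF assms(1)] assms(2)] by simp
qed

lemma eigenvalue_iff_conj_mat_diag:
  assumes "M \<in> carrier_mat n n" "upper_triangular (conj_mat M)"
  shows "eigenvalue M z \<longleftrightarrow> (\<exists>j<n. z = conj_mat M $$ (j, j))"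
  unfolding eigenvalue_root_char_poly[OF assms(1)] char_poly_conj_mat[OF assms]
  by (auto simp: poly_prod)

lemma index_conj_mat:
  assumes "M \<in> carrier_mat n n" "r < n" "c < n"
  shows "conj_mat M $$ (r, c) = (\<Sum>k<n. \<Sum>i<n. Q $$ (r, i) * M $$ (i, k) * P $$ (k, c))"
proof -
  have "conj_mat M $$ (r, c) = (\<Sum>k<n. (\<Sum>i<n. Q $$ (r, i) * M $$ (i, k)) * P $$ (k, c))"
    unfolding conj_mat_def using assms P Q
    by (simp add: scalar_prod_def atLeast0LessThan del: assoc_mult_mat)
  then show ?thesis
    by (simp add: sum_distrib_right)
qed

text \<open>Linearity of conjugation at the level of entries, the form in which \<open>Co\<close>
  builds its combinations; it amounts to exchanging finite sums.\<close>

lemma conj_mat_combination: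
  assumes T: "finite T" "T \<subseteq> carrier_mat n n" and rc: "r < n" "c < n"
  shows "conj_mat (mat n n (\<lambda>(r, c). \<Sum>M\<in>T. a M * M $$ (r, c))) $$ (r, c) = (\<Sum>M\<in>T. a M * conj_mat M $$ (r, c))"
proof -
  have "conj_mat (mat n n (\<lambda>(r, c). \<Sum>M\<in>T. a M * M $$ (r, c))) $$ (r, c)
      = (\<Sum>k<n. \<Sum>i<n. \<Sum>M\<in>T. a M * (Q $$ (r, i) * M $$ (i, k) * P $$ (k, c)))"
    using rc by (subst index_conj_mat) (auto intro!: sum.cong simp: sum_distrib_left sum_distrib_right algebra_simps)
  also have "\<dots> = (\<Sum>k<n. \<Sum>M\<in>T. \<Sum>i<n. a M * (Q $$ (r, i) * M $$ (i, k) * P $$ (k, c)))"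
    by (intro sum.cong refl sum.swap)
  also have "\<dots> = (\<Sum>M\<in>T. \<Sum>k<n. \<Sum>i<n. a M * (Q $$ (r, i) * M $$ (i, k) * P $$ (k, c)))"
    by (rule sum.swap)
  also have "\<dots> = (\<Sum>M\<in>T. a M * conj_mat M $$ (r, c))"
  proof (rule sum.cong[OF refl])
    fix M assume "M \<in> T"
    then have "M \<in> carrier_mat n n" using T by auto
    then show "(\<Sum>k<n. \<Sum>i<n. a M * (Q $$ (r, i) * M $$ (i, k) * P $$ (k, c))) = a M * conj_mat M $$ (r, c)"
      using rc by (simp add: index_conj_mat sum_distrib_left)
  qed
  finally show ?thesis .
qed

text \<open>Stated for an arbitrary set made triangular by one conjugation, so that it serves G as
  well as sets of 1-by-1 matrices.\<close>

lemma HS_eq_Union_convex_hull: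
  assumes S: "S \<subseteq> carrier_mat n n" and ut: "\<And>M. M \<in> S \<Longrightarrow> upper_triangular (conj_mat M)"
  shows "HS n S = (\<Union>j<n. convex hull ((\<lambda>M. conj_mat M $$ (j, j)) ` S))"
proof -
  define comb where "comb T u = mat n n (\<lambda>(r, c). \<Sum>M\<in>T. complex_of_real (u M) * M $$ (r, c))"
    for T :: "complex mat set" and u :: "complex mat \<Rightarrow> real"
  have eig: "eigenvalue (comb T u) z \<longleftrightarrow> (\<exists>j<n. z = (\<Sum>M\<in>T. u M *\<^sub>R conj_mat M $$ (j, j)))"
    if T: "finite T" "T \<subseteq> S" for T u z
  proof -
    have car: "comb T u \<in> carrier_mat n n" by (simp add: comb_def)
    have entry: "conj_mat (comb T u) $$ (r, c) = (\<Sum>M\<in>T. complex_of_real (u M) * conj_mat M $$ (r, c))"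
      if "r < n" "c < n" for r c
      unfolding comb_def using T S that by (intro conj_mat_combination) auto
    have "upper_triangular (conj_mat (comb T u))"
    proof (rule upper_triangularI)
      fix i j assume ij: "j < i" "i < dim_row (conj_mat (comb T u))"
      then have "i < n" "j < n" using conj_mat_carrier[OF car] by auto
      moreover have "conj_mat M $$ (i, j) = 0" if "M \<in> T" for M
        using upper_triangularD[OF ut ij(1)] conj_mat_carrier[of M] that T S \<open>i < n\<close> by auto
      ultimately show "conj_mat (comb T u) $$ (i, j) = 0"
        by (simp add: entry)
    qed
    then show ?thesis
      using eigenvalue_iff_conj_mat_diag[OF car] by (auto simp: entry scaleR_conv_of_real)
  qed
  show ?thesis
  proof (intro equalityI subsetI)
    fix z assume "z \<in> HS n S"
    then obtain T u where T: "finite T" "T \<subseteq> S" "\<forall>M\<in>T. 0 \<le> u M" "sum u T = 1" "eigenvalue (comb T u) z"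
      by (auto simp: HS_def Co_def comb_def)
    then obtain j where j: "j < n" "z = (\<Sum>M\<in>T. u M *\<^sub>R conj_mat M $$ (j, j))"
      using eig by blast
    have "z \<in> convex hull ((\<lambda>M. conj_mat M $$ (j, j)) ` S)"
      unfolding j(2) using T by (intro convex_sum convex_convex_hull hull_inc) auto
    then show "z \<in> (\<Union>j<n. convex hull ((\<lambda>M. conj_mat M $$ (j, j)) ` S))"
      using j(1) by blast
  next
    fix z assume "z \<in> (\<Union>j<n. convex hull ((\<lambda>M. conj_mat M $$ (j, j)) ` S))"
    then obtain j where j: "j < n" "z \<in> convex hull ((\<lambda>M. conj_mat M $$ (j, j)) ` S)"
      by blast
    define f where "f M = conj_mat M $$ (j, j)" for M
    obtain F u where F: "finite F" "F \<subseteq> f ` S" "\<forall>x\<in>F. 0 \<le> u x" "sum u F = 1" "(\<Sum>x\<in>F. u x *\<^sub>R x) = z"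
      using j(2) unfolding convex_hull_explicit f_def by blast
    \<comment> \<open>Different matrices may share a diagonal entry. One preimage is chosen for each
      point of F, so that the weights carry over unchanged.\<close>
    obtain T where T: "T \<subseteq> S" "finite T" "inj_on f T" "F = f ` T"
      using F(1,2) finite_imageD unfolding subset_image_inj by metis
    have "(\<Sum>M\<in>T. u (f M)) = 1" "z = (\<Sum>M\<in>T. u (f M) *\<^sub>R f M)"
      using F(4,5) T by (simp_all add: sum.reindex)
    then have "comb T (u \<circ> f) \<in> Co n S" "eigenvalue (comb T (u \<circ> f)) z"
      using T F(3) j(1) by (auto simp: Co_def comb_def eig[OF T(2,1), unfolded comb_def] f_def)
    then show "z \<in> HS n S"
      by (auto simp: HS_def)
  qed
qed

text \<open>Needed because joint eigenvalues come with a conjugation that is only known to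
  triangularize the generators.\<close>

lemma upper_triangular_generate:
  assumes K: "K \<subseteq> carrier (GL n)" and ut: "\<And>M. M \<in> K \<Longrightarrow> upper_triangular (conj_mat M)"
    and M: "M \<in> generate (GL n) K"
  shows "upper_triangular (conj_mat M)"
  using M
proof (induction rule: generate.induct)
  case one
  then show ?case by (simp add: GL_one conj_mat_one)
next
  case (incl h)
  then show ?case using ut by blast
next
  case (inv h)
  interpret group "GL n" by (rule GL_group)
  have h: "h \<in> carrier (GL n)" using inv K by blast
  have car: "h \<in> carrier_mat n n" "inv\<^bsub>GL n\<^esub> h \<in> carrier_mat n n"
    using h inv_closed[OF h] by (simp_all add: GL_carrier)
  have "h * inv\<^bsub>GL n\<^esub> h = 1\<^sub>m n" "inv\<^bsub>GL n\<^esub> h * h = 1\<^sub>m n"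
    using h r_inv[OF h] l_inv[OF h] by (simp_all add: GL_mult GL_one)
  then have "conj_mat h * conj_mat (inv\<^bsub>GL n\<^esub> h) = 1\<^sub>m n" "conj_mat (inv\<^bsub>GL n\<^esub> h) * conj_mat h = 1\<^sub>m n"
    using car by (simp_all add: conj_mat_one flip: conj_mat_mult)
  then show ?case
    using upper_triangular_inverse[OF conj_mat_carrier[OF car(1)] ut[OF inv] conj_mat_carrier[OF car(2)]] by blast
next
  case (eng g h)
  have "g \<in> carrier_mat n n" "h \<in> carrier_mat n n"
    using eng(1,2) group.generate_in_carrier[OF GL_group K] by (auto simp: GL_carrier)
  then show ?case
    using eng.IH upper_triangular_mult[OF conj_mat_carrier _ conj_mat_carrier]
    by (simp add: GL_mult conj_mat_mult)
qed

end

section \<open>Diagonal characters of a triangularized group\<close>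

locale triangularized_group = inverse_mats n P Q for n P Q +
  fixes G :: "complex mat set"
  assumes subgroup: "subgroup G (GL n)"
    and triangular: "\<And>M. M \<in> G \<Longrightarrow> upper_triangular (conj_mat M)"
begin

definition diag_char :: "nat \<Rightarrow> complex mat \<Rightarrow> complex" where
  "diag_char j M = conj_mat M $$ (j, j)"

lemma mem_carrier_mat: "M \<in> G \<Longrightarrow> M \<in> carrier_mat n n"
  using subgroup.subset[OF subgroup] by (auto simp: GL_carrier)

lemma diag_char_mult:
  assumes "M \<in> G" "N \<in> G" "j < n"
  shows "diag_char j (M * N) = diag_char j M * diag_char j N"
  unfolding diag_char_def conj_mat_mult[OF mem_carrier_mat[OF assms(1)] mem_carrier_mat[OF assms(2)]]
  by (intro index_mult_upper_triangular_diag[of _ n] conj_mat_carrier mem_carrier_mat triangular assms)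

lemma diag_char_one: "j < n \<Longrightarrow> diag_char j (1\<^sub>m n) = 1"
  by (simp add: diag_char_def conj_mat_one)

text \<open>The product form yields at once that the character values are nonzero and that their
  inverses are again values.\<close>

lemma diag_char_inv:
  assumes "M \<in> G" "j < n"
  shows "diag_char j M * diag_char j (inv\<^bsub>GL n\<^esub> M) = 1"
proof -
  have "M * inv\<^bsub>GL n\<^esub> M = 1\<^sub>m n"
    using group.r_inv[OF GL_group] subgroup.mem_carrier[OF subgroup assms(1)] by (simp add: GL_mult GL_one)
  then show ?thesis
    using diag_char_mult[OF assms(1) subgroup.m_inv_closed[OF subgroup assms(1)] assms(2)] diag_char_one[OF assms(2)]
    by simp
qed

lemma diag_char_subgroup:
  assumes j: "j < n"
  shows "nonzero_complex_subgroup (diag_char j ` G)"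
proof
  show "1 \<in> diag_char j ` G"
    using diag_char_one[OF j] subgroup.one_closed[OF subgroup] by (force simp: GL_one)
  show "x * y \<in> diag_char j ` G" if "x \<in> diag_char j ` G" "y \<in> diag_char j ` G" for x y
    using that subgroup.m_closed[OF subgroup] diag_char_mult[OF _ _ j] by (force simp: GL_mult)
  show "inverse x \<in> diag_char j ` G" if x: "x \<in> diag_char j ` G" for x
  proof -
    obtain M where M: "M \<in> G" "x = diag_char j M" using x by blast
    have "inverse x = diag_char j (inv\<^bsub>GL n\<^esub> M)"
      using diag_char_inv[OF M(1) j] M(2) by (intro inverse_unique) simp
    then show ?thesis
      using subgroup.m_inv_closed[OF subgroup M(1)] by blast
  qed
  show "0 \<notin> diag_char j ` G"
    using diag_char_inv[OF _ j] by force
qed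

lemma HS_eq: "HS n G = (\<Union>j<n. convex hull (diag_char j ` G))"
  using HS_eq_Union_convex_hull[OF _ triangular] mem_carrier_mat unfolding diag_char_def by blast

text \<open>A homomorphism maps a generated group onto the group generated by the images. The
  diagonal entry is known to be multiplicative only on G, so generation is first moved from
  \<open>GL n\<close> into the group on G.\<close>

lemma scalar_group_diag_char:
  assumes j: "j < n" and K: "K \<subseteq> G" "generate (GL n) K = G"
  shows "scalar_group (diag_char j ` K) = scalar_mat ` diag_char j ` G"
proof -
  let ?H = "(GL n)\<lparr>carrier := G\<rparr>"
  interpret H: group ?H
    using subgroup.subgroup_is_group[OF subgroup GL_group] .
  interpret GL1: group "GL 1" by (rule GL_group)
  interpret h: group_hom ?H "GL 1" "\<lambda>M. scalar_mat (diag_char j M)"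
  proof
    show "(\<lambda>M. scalar_mat (diag_char j M)) \<in> hom ?H (GL 1)"
      using nonzero_complex_subgroup.zero_notin[OF diag_char_subgroup[OF j]] j
      by (intro homI) (force intro!: scalar_mat_GL, simp add: GL_mult diag_char_mult scalar_mat_mult)
  qed
  have "scalar_group (diag_char j ` K) = generate (GL 1) ((\<lambda>M. scalar_mat (diag_char j M)) ` K)"
    by (simp add: scalar_group_def image_image)
  also have "\<dots> = (\<lambda>M. scalar_mat (diag_char j M)) ` generate ?H K"
    using K by (intro h.generate_img) simp
  also have "generate ?H K = G"
    using group.generate_consistent[OF GL_group K(1) subgroup] K(2) by simp
  finally show ?thesis by (simp add: image_image)
qed

end

text \<open>A 1-by-1 matrix is triangular already, so conjugation by the identity suffices. This
  turns the hull spectra of the scalar groups into convex hulls.\<close>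

lemma HS_scalar: "HS 1 (scalar_mat ` Z) = convex hull Z"
proof -
  interpret inverse_mats 1 "1\<^sub>m 1" "1\<^sub>m 1"
    by unfold_locales auto
  have conj: "conj_mat (scalar_mat z) = scalar_mat z" for z
    unfolding conj_mat_def using scalar_mat_carrier[of z] by (simp only: left_mult_one_mat right_mult_one_mat)
  have "upper_triangular (scalar_mat z)" for z
    by (auto simp: scalar_mat_def)
  then have "HS 1 (scalar_mat ` Z) = (\<Union>j<1. convex hull ((\<lambda>M. conj_mat M $$ (j, j)) ` scalar_mat ` Z))"
    using scalar_mat_carrier by (intro HS_eq_Union_convex_hull) (auto simp only: conj)
  also have "\<dots> = convex hull ((\<lambda>z. conj_mat (scalar_mat z) $$ (0, 0)) ` Z)"
    by (simp only: image_image lessThan_Suc lessThan_0 One_nat_def image_insert image_empty Union_insert Union_empty Un_empty_right)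
  finally show ?thesis
    unfolding conj by (simp add: scalar_mat_def)
qed

theorem theorem3p4:
  fixes n :: nat and G :: "complex mat set"
    and I :: "'i set" and A :: "'i \<Rightarrow> complex mat"
  assumes "subgroup G (GL n)"
    and "comm_group ((GL n)\<lparr>carrier := G\<rparr>)"
    and "generate (GL n) (A ` I) = G"
  shows "(\<exists>lam. joint_eigenvalues n I A lam) \<and>
    (\<forall>lam. joint_eigenvalues n I A lam \<longrightarrow>
       HS n G = (\<Union>j<n. HS 1 (scalar_group ((\<lambda>i. lam i j) ` I)))) \<and>
    (\<exists>\<F>\<subseteq>hull_types. HS n G = \<Union>\<F>)"
proof (intro conjI allI impI)
  interpret comm: comm_group "(GL n)\<lparr>carrier := G\<rparr>" by fact
  have A: "A i \<in> G" if "i \<in> I" for i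
    using generate.incl[OF imageI[OF that, of A], of "GL n"] assms(3) by simp
  have G: "G \<subseteq> carrier (GL n)"
    using assms(1) by (rule subgroup.subset)
  then have G': "G \<subseteq> carrier_mat n n" by (auto simp: GL_carrier)
  have "M * N = N * M" if "M \<in> G" "N \<in> G" for M N
    using comm.m_comm[of M N] that by (simp add: GL_mult)
  then obtain P Q where PQ: "P \<in> carrier_mat n n" "Q \<in> carrier_mat n n" "P * Q = 1\<^sub>m n" "Q * P = 1\<^sub>m n"
    and ut: "\<And>M. M \<in> G \<Longrightarrow> upper_triangular (Q * M * P)"
    using simultaneous_triangularization[OF G'] by blast
  interpret inverse_mats n P Q
    using PQ by unfold_locales
  interpret triangularized_group n P Q G
    using inverse_mats_axioms assms(1) ut
    by (auto intro!: triangularized_group.intro triangularized_group_axioms.intro simp: conj_mat_def)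
  show "\<exists>lam. joint_eigenvalues n I A lam"
  proof
    show "joint_eigenvalues n I A (\<lambda>i j. conj_mat (A i) $$ (j, j))"
      unfolding joint_eigenvalues_def
      using A mem_carrier_mat triangular char_poly_conj_mat similar_conj_mat by blast
  qed
  show "\<exists>\<F>\<subseteq>hull_types. HS n G = \<Union>\<F>"
  proof -
    have "\<forall>j\<in>{..<n}. \<exists>\<F>\<subseteq>hull_types. convex hull (diag_char j ` G) = \<Union>\<F>"
      using nonzero_complex_subgroup.hull_Union_hull_types[OF diag_char_subgroup] by blast
    then obtain \<F> where "\<forall>j\<in>{..<n}. \<F> j \<subseteq> hull_types \<and> convex hull (diag_char j ` G) = \<Union>(\<F> j)"
      by metis
    then show ?thesis
      unfolding HS_eq by (intro exI[of _ "\<Union>j<n. \<F> j"]) auto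
  qed
  \<comment> \<open>An arbitrary compatible ordering may belong to another triangularization than P,
    Q, so the group is triangularized anew along the pair that \<open>joint\<close>
    provides.\<close>
  fix lam assume joint: "joint_eigenvalues n I A lam"
  show "HS n G = (\<Union>j<n. HS 1 (scalar_group ((\<lambda>i. lam i j) ` I)))"
  proof -
    obtain P' Q' where PQ': "inverse_mats n P' Q'"
      and lam: "\<And>i. i \<in> I \<Longrightarrow> upper_triangular (inverse_mats.conj_mat P' Q' (A i)) \<and>
        (\<forall>j<n. inverse_mats.conj_mat P' Q' (A i) $$ (j, j) = lam i j)"
    proof (cases "I = {}")
      \<comment> \<open>Without generators \<open>joint\<close> says nothing about its matrices, not
        even that they are inverse to each other; the identity pair replaces them.\<close>
      case True
      have "inverse_mats n (1\<^sub>m n) (1\<^sub>m n)" by unfold_locales auto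
      then show ?thesis using True that by blast
    next
      case False
      obtain P' Q' where wit: "\<And>i. i \<in> I \<Longrightarrow> \<exists>B. similar_mat_wit (A i) B P' Q' \<and> upper_triangular B \<and>
          (\<forall>j<n. B $$ (j, j) = lam i j)"
        using joint unfolding joint_eigenvalues_def by blast
      \<comment> \<open>Inverting the similarity determines B from P' and Q', so the triangular
        forms of all generators arise from one conjugation.\<close>
      have D: "inverse_mats n P' Q' \<and> B = Q' * A i * P'" if "i \<in> I" "similar_mat_wit (A i) B P' Q'" for i B
      proof -
        note w = similar_mat_witD2[OF mem_carrier_mat[OF A[OF that(1)]] that(2)]
        have "Q' * A i * P' = (Q' * P') * B * (Q' * P')"
          unfolding w(3) using w(5-7) by (simp add: assoc_mult_mat[of _ n n _ n _ n])
        then show ?thesis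
          using w by (auto simp: inverse_mats_def)
      qed
      obtain i where "i \<in> I" using False by blast
      then have inv': "inverse_mats n P' Q'" using wit D by blast
      then show ?thesis
        using wit D that[OF inv'] unfolding inverse_mats.conj_mat_def[OF inv'] by metis
    qed
    interpret T': inverse_mats n P' Q' by (rule PQ')
    interpret T': triangularized_group n P' Q' G
    proof (intro triangularized_group.intro triangularized_group_axioms.intro PQ')
      show "subgroup G (GL n)" by fact
      show "upper_triangular (T'.conj_mat M)" if "M \<in> G" for M
        using T'.upper_triangular_generate[of "A ` I" M] lam A G that assms(3) by auto
    qed
    have "HS 1 (scalar_group ((\<lambda>i. lam i j) ` I)) = convex hull (T'.diag_char j ` G)" if j: "j < n" for j
    proof -
      have "(\<lambda>i. lam i j) ` I = T'.diag_char j ` A ` I"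
        using lam j by (simp add: image_image T'.diag_char_def)
      moreover have "A ` I \<subseteq> G" using A by blast
      ultimately show ?thesis
        by (simp only: T'.scalar_group_diag_char[OF j _ assms(3)] HS_scalar)
    qed
    then show ?thesis
      using T'.HS_eq by simp
  qed
qed

end
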